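(* Let $\Gamma$ be a finite simplicial graph and $W_\Gamma$ the associated right-angled Coxeter group. Decompose $W_\Gamma\cong W_{\Gamma_1}\times\ldots\times W_{\Gamma_n}$ as a direct product where the factors are directly indecomposable special parabolic subgroups. There exists an infinite virtually abelian normal subgroup in $\mathrm{Aut}(W_\Gamma)$ if and only if there exists an $i\in\{1,\ldots,n\}$ such that $W_{\Gamma_i}\cong\mathbb{Z}/2\mathbb{Z}*\mathbb{Z}/2\mathbb{Z}$. Otherwise (i.e. if no such $i$ exists), every normal subgroup of $\mathrm{Aut}(W_\Gamma)$ is either finite or full-sized.
   Context: For a finite simplicial graph $\Gamma$, the right-angled Coxeter group is $W_\Gamma=\langle V(\Gamma)\mid v^2=1 \text{ for all } v\in V(\Gamma),\ vw=wv\text{ whenever }\{v,w\}\in E(\Gamma)\rangle$ (the graph product over $\Gamma$ with all vertex groups cyclic of order two). For an induced subgraph $\Omega\subseteq\Gamma$, the subgroup generated by $V(\Omega)$ is canonically isomorphic to $W_\Omega$ and is called a special parabolic subgroup. $W_\Omega$ is directly decomposable if it is a direct product of proper special parabolic subgroups, equivalently if $\Omega$ is a join (its vertex set has a partition into two non-empty parts with every vertex of one adjacent to every vertex of the other); otherwise directly indecomposable. So the decomposition corresponds to writing $\Gamma=\Gamma_1*\cdots*\Gamma_n$ as a join of induced subgraphs none of which is itself a join. A group is called full-sized if it contains a non-abelian free group $F_2$ as a subgroup. *)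

theory Defs
  imports "HOL-Algebra.Bij" "HOL-Algebra.Elementary_Groups"
begin

section \<open>Group presentations\<close>

text \<open>A letter \<open>(x, True)\<close> stands for the generator \<open>x\<close>, a letter \<open>(x, False)\<close> for its
  formal inverse. The free group on \<open>S\<close> consists of the classes of words over these letters
  modulo insertion and deletion of mutually inverse neighbours.\<close>

type_synonym 'a word = "('a \<times> bool) list"

definition words :: "'a set \<Rightarrow> 'a word set" where
  "words S = lists (S \<times> UNIV)"

inductive_set free_cong :: "'a set \<Rightarrow> ('a word \<times> 'a word) set" for S where
  refl: "w \<in> words S \<Longrightarrow> (w, w) \<in> free_cong S"
| sym: "(u, v) \<in> free_cong S \<Longrightarrow> (v, u) \<in> free_cong S"
| trans: "(u, v) \<in> free_cong S \<Longrightarrow> (v, w) \<in> free_cong S \<Longrightarrow> (u, w) \<in> free_cong S"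
| cancel: "u \<in> words S \<Longrightarrow> v \<in> words S \<Longrightarrow> x \<in> S \<Longrightarrow>
    (u @ [(x, b), (x, \<not> b)] @ v, u @ v) \<in> free_cong S"

definition word_class :: "'a set \<Rightarrow> 'a word \<Rightarrow> 'a word set" where
  "word_class S w = free_cong S `` {w}"

definition free_group :: "'a set \<Rightarrow> 'a word set monoid" where
  "free_group S =
     \<lparr>carrier = words S // free_cong S,
      monoid.mult = (\<lambda>A B. \<Union>a\<in>A. \<Union>b\<in>B. word_class S (a @ b)),
      monoid.one = word_class S []\<rparr>"

definition normal_closure :: "('a, 'b) monoid_scheme \<Rightarrow> 'a set \<Rightarrow> 'a set" where
  "normal_closure G R = \<Inter>{N. N \<lhd> G \<and> R \<subseteq> N}"

definition relator_subgroup :: "'a set \<Rightarrow> 'a word set \<Rightarrow> 'a word set set" where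
  "relator_subgroup S R = normal_closure (free_group S) (word_class S ` R)"

definition presented_group :: "'a set \<Rightarrow> 'a word set \<Rightarrow> 'a word set set monoid" where
  "presented_group S R = free_group S Mod relator_subgroup S R"

definition presented_gen :: "'a set \<Rightarrow> 'a word set \<Rightarrow> 'a \<Rightarrow> 'a word set set" where
  "presented_gen S R x = relator_subgroup S R #>\<^bsub>free_group S\<^esub> word_class S [(x, True)]"

text \<open>The free product is presented by the disjoint union of the two carriers, subject to
  the two multiplication tables: the relators spell \<open>x y (x y)\<^sup>-\<^sup>1\<close> inside each factor.\<close>

definition free_product ::
    "('a, 'c) monoid_scheme \<Rightarrow> ('b, 'd) monoid_scheme \<Rightarrow> ('a + 'b) word set set monoid" where
  "free_product G H = presented_group (carrier G <+> carrier H)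
     ({[(Inl x, True), (Inl y, True), (Inl (x \<otimes>\<^bsub>G\<^esub> y), False)] | x y.
         x \<in> carrier G \<and> y \<in> carrier G} \<union>
      {[(Inr x, True), (Inr y, True), (Inr (x \<otimes>\<^bsub>H\<^esub> y), False)] | x y.
         x \<in> carrier H \<and> y \<in> carrier H})"


section \<open>Group-theoretic notions\<close>

definition internal_direct_product ::
    "('a, 'b) monoid_scheme \<Rightarrow> 'i set \<Rightarrow> ('i \<Rightarrow> 'a set) \<Rightarrow> bool" where
  "internal_direct_product G I H \<longleftrightarrow>
     (\<forall>i\<in>I. subgroup (H i) G) \<and>
     (\<forall>i\<in>I. \<forall>j\<in>I. i \<noteq> j \<longrightarrow> (\<forall>x\<in>H i. \<forall>y\<in>H j. x \<otimes>\<^bsub>G\<^esub> y = y \<otimes>\<^bsub>G\<^esub> x)) \<and>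
     generate G (\<Union>i\<in>I. H i) = carrier G \<and>
     (\<forall>i\<in>I. H i \<inter> generate G (\<Union>j\<in>I - {i}. H j) = {\<one>\<^bsub>G\<^esub>})"

definition virtually_abelian :: "('a, 'b) monoid_scheme \<Rightarrow> bool" where
  "virtually_abelian G \<longleftrightarrow>
     (\<exists>A. subgroup A G \<and> comm_group (G\<lparr>carrier := A\<rparr>) \<and> finite (rcosets\<^bsub>G\<^esub> A))"

text \<open>The type \<open>bool\<close> merely serves as a two-element set of free generators.\<close>

definition full_sized :: "('a, 'b) monoid_scheme \<Rightarrow> bool" where
  "full_sized G \<longleftrightarrow>
     (\<exists>H. subgroup H G \<and> free_group (UNIV :: bool set) \<cong> G\<lparr>carrier := H\<rparr>)"


section \<open>Right-angled Coxeter groups\<close>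

definition finite_simplicial_graph :: "'a set \<Rightarrow> 'a set set \<Rightarrow> bool" where
  "finite_simplicial_graph V E \<longleftrightarrow> finite V \<and> (\<forall>e\<in>E. e \<subseteq> V \<and> card e = 2)"

definition racg_relators :: "'a set \<Rightarrow> 'a set set \<Rightarrow> 'a word set" where
  "racg_relators V E =
     {[(v, True), (v, True)] | v. v \<in> V} \<union>
     {[(v, True), (w, True), (v, False), (w, False)] | v w. v \<in> V \<and> w \<in> V \<and> {v, w} \<in> E}"

definition racg :: "'a set \<Rightarrow> 'a set set \<Rightarrow> 'a word set set monoid" where
  "racg V E = presented_group V (racg_relators V E)"

text \<open>Vertex sets \<open>\<Omega> \<subseteq> V\<close> stand for the subgraphs they induce.\<close>

definition special_parabolic :: "'a set \<Rightarrow> 'a set set \<Rightarrow> 'a set \<Rightarrow> 'a word set set set" where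
  "special_parabolic V E \<Omega> = generate (racg V E) (presented_gen V (racg_relators V E) ` \<Omega>)"

abbreviation parabolic_group ::
    "'a set \<Rightarrow> 'a set set \<Rightarrow> 'a set \<Rightarrow> 'a word set set monoid" where
  "parabolic_group V E \<Omega> \<equiv> (racg V E)\<lparr>carrier := special_parabolic V E \<Omega>\<rparr>"

definition directly_decomposable :: "'a set \<Rightarrow> 'a set set \<Rightarrow> 'a set \<Rightarrow> bool" where
  "directly_decomposable V E \<Omega> \<longleftrightarrow>
     (\<exists>A B. A \<subset> \<Omega> \<and> B \<subset> \<Omega> \<and>
        internal_direct_product (parabolic_group V E \<Omega>) (UNIV :: bool set)
          (\<lambda>b. special_parabolic V E (if b then A else B)))"


section \<open>Well-definedness\<close>

lemma words_append [simp]: "u @ v \<in> words S \<longleftrightarrow> u \<in> words S \<and> v \<in> words S"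
  by (auto simp: words_def)

lemma words_Nil [simp]: "[] \<in> words S"
  by (simp add: words_def)

lemma words_Cons [simp]: "a # w \<in> words S \<longleftrightarrow> fst a \<in> S \<and> w \<in> words S"
  by (cases a) (auto simp: words_def)

lemma free_cong_words: "(u, v) \<in> free_cong S \<Longrightarrow> u \<in> words S \<and> v \<in> words S"
  by (induction rule: free_cong.induct) auto

lemma equiv_free_cong: "equiv (words S) (free_cong S)"
proof (rule equivI)
  show "free_cong S \<subseteq> words S \<times> words S"
    by (auto dest: free_cong_words)
  show "refl_on (words S) (free_cong S)"
    by (auto simp: refl_on_def intro: free_cong.refl)
  show "sym (free_cong S)"
    by (auto simp: sym_def intro: free_cong.sym)
  show "trans (free_cong S)"
    by (rule transI) (rule free_cong.trans)
qed

lemma free_cong_append_right: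
  "(u, v) \<in> free_cong S \<Longrightarrow> w \<in> words S \<Longrightarrow> (u @ w, v @ w) \<in> free_cong S"
proof (induction rule: free_cong.induct)
  case (cancel u v x b)
  then show ?case using free_cong.cancel[of u S "v @ w" x b] by simp
next
  case (sym u v)
  then show ?case by (simp add: free_cong.sym)
next
  case (trans u v w')
  then show ?case using free_cong.trans by blast
qed (simp add: free_cong.refl)

lemma free_cong_append_left:
  "(u, v) \<in> free_cong S \<Longrightarrow> w \<in> words S \<Longrightarrow> (w @ u, w @ v) \<in> free_cong S"
proof (induction rule: free_cong.induct)
  case (cancel u v x b)
  then show ?case using free_cong.cancel[of "w @ u" S v x b] by simp
next
  case (sym u v)
  then show ?case by (simp add: free_cong.sym)
next
  case (trans u v w')
  then show ?case using free_cong.trans by blast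
qed (simp add: free_cong.refl)

lemma free_cong_append:
  assumes "(u, u') \<in> free_cong S" "(v, v') \<in> free_cong S"
  shows "(u @ v, u' @ v') \<in> free_cong S"
proof (rule free_cong.trans)
  show "(u @ v, u' @ v) \<in> free_cong S"
    using assms free_cong_words by (blast intro: free_cong_append_right)
  show "(u' @ v, u' @ v') \<in> free_cong S"
    using assms free_cong_words by (blast intro: free_cong_append_left)
qed

lemma word_class_eq_iff:
  "u \<in> words S \<Longrightarrow> v \<in> words S \<Longrightarrow> word_class S u = word_class S v \<longleftrightarrow> (u, v) \<in> free_cong S"
  unfolding word_class_def using eq_equiv_class_iff[OF equiv_free_cong] by blast

lemma carrier_free_group: "carrier (free_group S) = word_class S ` words S"
  by (auto simp: free_group_def word_class_def quotient_def)

lemma mult_free_group: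
  assumes "u \<in> words S" "v \<in> words S"
  shows "word_class S u \<otimes>\<^bsub>free_group S\<^esub> word_class S v = word_class S (u @ v)"
proof -
  have "word_class S (a @ b) = word_class S (u @ v)"
    if "a \<in> word_class S u" "b \<in> word_class S v" for a b
  proof -
    have "(u, a) \<in> free_cong S" "(v, b) \<in> free_cong S"
      using that by (auto simp: word_class_def)
    then have "(u @ v, a @ b) \<in> free_cong S"
      by (rule free_cong_append)
    then show ?thesis
      unfolding word_class_def using equiv_class_eq[OF equiv_free_cong] by metis
  qed
  moreover have "u \<in> word_class S u" "v \<in> word_class S v"
    using assms by (auto simp: word_class_def intro: free_cong.refl)
  ultimately have "(\<Union>a\<in>word_class S u. \<Union>b\<in>word_class S v. word_class S (a @ b)) =
      word_class S (u @ v)"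
    by blast
  then show ?thesis
    by (simp add: free_group_def)
qed

lemma one_free_group: "\<one>\<^bsub>free_group S\<^esub> = word_class S []"
  by (simp add: free_group_def)

lemma free_cong_inverse:
  "w \<in> words S \<Longrightarrow> (rev (map (\<lambda>(x, b). (x, \<not> b)) w) @ w, []) \<in> free_cong S"
proof (induction w)
  case Nil
  then show ?case by (simp add: free_cong.refl)
next
  case (Cons a w)
  obtain x b where a: "a = (x, b)" by force
  let ?w' = "rev (map (\<lambda>(x, b). (x, \<not> b)) w)"
  have w: "w \<in> words S" "x \<in> S" using Cons.prems a by auto
  have "?w' @ w \<in> words S" using Cons.IH w free_cong_words by blast
  then have "(?w' @ [(x, \<not> b), (x, \<not> \<not> b)] @ w, ?w' @ w) \<in> free_cong S"
    using w by (intro free_cong.cancel) auto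
  then have "(?w' @ [(x, \<not> b), (x, \<not> \<not> b)] @ w, []) \<in> free_cong S"
    using Cons.IH w by (blast intro: free_cong.trans)
  then show ?case using a by simp
qed

lemma group_free_group: "group (free_group S)"
proof (rule groupI)
  fix X assume "X \<in> carrier (free_group S)"
  then obtain w where w: "w \<in> words S" "X = word_class S w"
    by (auto simp: carrier_free_group)
  let ?w' = "rev (map (\<lambda>(x, b). (x, \<not> b)) w)"
  have c: "(?w' @ w, []) \<in> free_cong S" using w free_cong_inverse by blast
  then have "?w' \<in> words S" using free_cong_words by fastforce
  moreover from this have "word_class S ?w' \<otimes>\<^bsub>free_group S\<^esub> X = \<one>\<^bsub>free_group S\<^esub>"
    using w c by (simp add: mult_free_group one_free_group word_class_eq_iff)
  ultimately show "\<exists>Y\<in>carrier (free_group S). Y \<otimes>\<^bsub>free_group S\<^esub> X = \<one>\<^bsub>free_group S\<^esub>"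
    by (auto simp: carrier_free_group)
qed (auto simp: carrier_free_group mult_free_group one_free_group)

lemma (in group) normal_normal_closure:
  assumes "R \<subseteq> carrier G"
  shows "normal_closure G R \<lhd> G"
proof (rule normal_invI)
  have c: "carrier G \<lhd> G"
    by (simp add: normal_inv_iff subgroup_self)
  show "subgroup (normal_closure G R) G"
    unfolding normal_closure_def
    by (rule subgroups_Inter) (use c assms normal_imp_subgroup in auto)
  show "x \<otimes> h \<otimes> inv x \<in> normal_closure G R"
    if "x \<in> carrier G" "h \<in> normal_closure G R" for x h
    using that by (auto simp: normal_closure_def normal_inv_iff)
qed

lemma group_presented_group:
  assumes "R \<subseteq> words S"
  shows "group (presented_group S R)"
proof -
  interpret group "free_group S" by (rule group_free_group)
  have "relator_subgroup S R \<lhd> free_group S"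
    unfolding relator_subgroup_def using assms
    by (intro normal_normal_closure) (auto simp: carrier_free_group)
  then show ?thesis
    unfolding presented_group_def by (rule normal.factorgroup_is_group)
qed

lemma group_racg: "group (racg V E)"
  unfolding racg_def racg_relators_def by (rule group_presented_group) auto

lemma group_free_product:
  assumes "group G" "group H"
  shows "group (free_product G H)"
proof -
  interpret G: group G by (rule assms(1))
  interpret H: group H by (rule assms(2))
  show ?thesis
    unfolding free_product_def by (rule group_presented_group) auto
qed

end

theory Submission
  imports Defs
begin

text \<open>Write \<open>W\<close> for the Coxeter group, \<open>s v\<close> for the generator belonging to the vertex \<open>v\<close> and \<open>c
g\<close> for conjugation by \<open>g\<close>. A normal subgroup \<open>N\<close> of \<open>Aut W\<close> is controlled by the normal subgroup
\<open>M = {g. c g \<in> N}\<close> of \<open>W\<close>: since \<open>f (c g) f\<^sup>-\<^sup>1 = c (f g)\<close>, every displacement \<open>f g \<cdot> g\<^sup>-\<^sup>1\<close> with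
\<open>f \<in> N\<close> lies in \<open>M\<close>. If \<open>M\<close> is central, then each \<open>f \<in> N\<close> moves the finitely many generators by
central elements only, and \<open>N\<close> is finite because the centre of \<open>W\<close> is (\<open>center_finite\<close>).

If \<open>M\<close> is not central, some \<open>m \<in> M\<close> does not commute with some \<open>s v\<close>. Killing \<open>s v\<close> retracts \<open>W\<close>
onto the subgroup generated by the other vertices, and the kernel of this retraction is the free
product of groups of order two, one for each conjugate of \<open>s v\<close> under that subgroup
(\<open>reduced_unique\<close>, \<open>normal_form\<close>). This is proved by letting \<open>W\<close> act on lists of such conjugates
without equal neighbours: \<open>s v\<close> toggles itself at the head of the list, and the other generators
conjugate all entries. The commutator of \<open>m\<close> with \<open>s v\<close> is a nontrivial element of \<open>M\<close> in this
free product. If \<open>s v\<close> has at least four conjugates, then two products of conjugates of this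
commutator begin and end with four different letters, so that no cancellation takes place in words
in them: they freely generate a free group of rank two inside \<open>M\<close> (\<open>free_pair\<close>), and as its
nontrivial elements are not central in \<open>W\<close>, it embeds into \<open>N\<close> (\<open>normal_subgroup_dichotomy\<close>).

A generator that is not central has four such conjugates unless it belongs to a dihedral factor
(\<open>four_conjugates\<close>): two vertices not adjacent to \<open>v\<close>, or a vertex \<open>w\<close> not adjacent to \<open>v\<close>
together with a third vertex not adjacent to \<open>w\<close>, give four conjugates that are told apart in a
permutational wreath product. Otherwise \<open>v\<close> and \<open>w\<close> are adjacent to all remaining vertices, hence
the indecomposable factor of \<open>v\<close> has no further vertex and is the infinite dihedral group.

Conversely, let \<open>t\<close> be the product of the two generating reflections of an infinite dihedral
factor. Every element of \<open>W\<close> centralizes or inverts \<open>t\<close>, from which one sees that \<open>t\<close> lies in the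
centre of the centralizer of all squares of \<open>W\<close>. That is an abelian subgroup invariant under all
automorphisms, and its image in \<open>Aut W\<close> is normal, abelian and infinite
(\<open>infinite_dihedral_factor\<close>). The two cases exclude each other because a virtually abelian group
contains no free group of rank two (\<open>virtually_abelian_not_full_sized\<close>).\<close>


section \<open>Universal properties of free and presented groups\<close>

definition eval_word :: "('b, 'c) monoid_scheme \<Rightarrow> ('a \<Rightarrow> 'b) \<Rightarrow> 'a word \<Rightarrow> 'b" where
  "eval_word H f w =
     foldr (\<lambda>(x, b) y. (if b then f x else inv\<^bsub>H\<^esub> f x) \<otimes>\<^bsub>H\<^esub> y) w \<one>\<^bsub>H\<^esub>"

lemma eval_word_Nil [simp]: "eval_word H f [] = \<one>\<^bsub>H\<^esub>"
  and eval_word_Cons [simp]: "eval_word H f ((x, b) # w) =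
    (if b then f x else inv\<^bsub>H\<^esub> f x) \<otimes>\<^bsub>H\<^esub> eval_word H f w"
  by (auto simp: eval_word_def)

lemma (in group) eval_word_closed:
  "f \<in> S \<rightarrow> carrier G \<Longrightarrow> w \<in> words S \<Longrightarrow> eval_word G f w \<in> carrier G"
  by (induction w) (auto simp: Pi_iff)

lemma (in group) eval_word_append:
  "f \<in> S \<rightarrow> carrier G \<Longrightarrow> u \<in> words S \<Longrightarrow> v \<in> words S \<Longrightarrow>
    eval_word G f (u @ v) = eval_word G f u \<otimes> eval_word G f v"
proof (induction u)
  case (Cons a u)
  then show ?case
    using eval_word_closed[of f S u] eval_word_closed[of f S v]
    by (cases a) (auto simp: m_assoc Pi_iff)
qed (simp add: eval_word_closed)

lemma (in group) eval_word_free_cong: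
  assumes "f \<in> S \<rightarrow> carrier G" "(u, v) \<in> free_cong S"
  shows "eval_word G f u = eval_word G f v"
  using assms(2)
proof (induction rule: free_cong.induct)
  case (cancel u v x b)
  then have c: "eval_word G f u \<in> carrier G" "eval_word G f v \<in> carrier G" "f x \<in> carrier G"
    using assms(1) eval_word_closed by auto
  have "eval_word G f ((x, b) # (x, \<not> b) # v) = eval_word G f v"
    using c by (simp flip: m_assoc)
  then show ?case
    using cancel assms(1) eval_word_append[OF assms(1), of u] by simp
qed auto

lemma (in group) eval_word_hom:
  assumes "group H" "h \<in> hom G H" "f \<in> S \<rightarrow> carrier G" "w \<in> words S"
  shows "h (eval_word G f w) = eval_word H (\<lambda>x. h (f x)) w"
proof -
  interpret h: group_hom G H h
    using assms by (simp add: group_hom_def group_hom_axioms_def)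
  show ?thesis
    using assms(4,3)
    by (induction w) (auto simp: eval_word_closed Pi_iff)
qed

lemma free_group_universal:
  assumes "group H" "f \<in> S \<rightarrow> carrier H"
  obtains h where "h \<in> hom (free_group S) H"
    "\<And>w. w \<in> words S \<Longrightarrow> h (word_class S w) = eval_word H f w"
proof -
  interpret H: group H by fact
  define h where "h A = the_elem (eval_word H f ` A)" for A
  have h: "h (word_class S w) = eval_word H f w" if "w \<in> words S" for w
  proof -
    have "eval_word H f ` word_class S w = {eval_word H f w}"
      using that assms(2) H.eval_word_free_cong
      by (fastforce simp: word_class_def intro: free_cong.refl)
    then show ?thesis by (simp add: h_def)
  qed
  have "h \<in> hom (free_group S) H"
    using assms(2)
    by (auto simp: hom_def carrier_free_group mult_free_group h H.eval_word_closed
        H.eval_word_append)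
  with h that show thesis by blast
qed

text \<open>Kernels are among the normal subgroups whose intersection is the normal closure. Hence a
homomorphism that kills the relators factors through the presented group.\<close>
lemma (in group_hom) normal_closure_sub_kernel:
  assumes "R \<subseteq> kernel G H h"
  shows "normal_closure G R \<subseteq> kernel G H h"
  unfolding normal_closure_def using assms normal_kernel by blast

lemma relator_subgroup_normal:
  assumes "R \<subseteq> words S"
  shows "relator_subgroup S R \<lhd> free_group S"
proof -
  interpret group "free_group S" by (rule group_free_group)
  show ?thesis
    unfolding relator_subgroup_def using assms
    by (intro normal_normal_closure) (auto simp: carrier_free_group)
qed

lemma presented_group_universal:
  assumes "R \<subseteq> words S" "group H" "f \<in> S \<rightarrow> carrier H"
    and "\<And>r. r \<in> R \<Longrightarrow> eval_word H f r = \<one>\<^bsub>H\<^esub>"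
  obtains h where "h \<in> hom (presented_group S R) H"
    "\<And>x. x \<in> S \<Longrightarrow> h (presented_gen S R x) = f x"
proof -
  interpret H: group H by fact
  interpret F: group "free_group S" by (rule group_free_group)
  obtain h where h: "h \<in> hom (free_group S) H"
    "\<And>w. w \<in> words S \<Longrightarrow> h (word_class S w) = eval_word H f w"
    using free_group_universal assms(2,3) by blast
  interpret h: group_hom "free_group S" H h
    using h by unfold_locales
  have "word_class S ` R \<subseteq> kernel (free_group S) H h"
    using assms(1,4) h(2) by (fastforce simp: kernel_def carrier_free_group)
  then have "relator_subgroup S R \<subseteq> kernel (free_group S) H h"
    unfolding relator_subgroup_def by (rule h.normal_closure_sub_kernel)
  then obtain g where g: "g \<in> hom (free_group S Mod relator_subgroup S R) H"
    "\<And>x. x \<in> carrier (free_group S) \<Longrightarrow> g (relator_subgroup S R #>\<^bsub>free_group S\<^esub> x) = h x"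
    using h.FactGroup_universal_kernel relator_subgroup_normal[OF assms(1)] by metis
  have "g (presented_gen S R x) = f x" if "x \<in> S" for x
    unfolding presented_gen_def using that assms(3) g(2) h(2)
    by (auto simp: carrier_free_group Pi_iff)
  with g(1) that show thesis unfolding presented_group_def by blast
qed

lemma presented_group_proj:
  assumes "R \<subseteq> words S"
  obtains p where "p \<in> hom (free_group S) (presented_group S R)"
    "p ` carrier (free_group S) = carrier (presented_group S R)"
    "\<And>x. p (word_class S [(x, True)]) = presented_gen S R x"
    "\<And>r. r \<in> R \<Longrightarrow> p (word_class S r) = \<one>\<^bsub>presented_group S R\<^esub>"
proof -
  interpret F: group "free_group S" by (rule group_free_group)
  interpret N: normal "relator_subgroup S R" "free_group S"
    using assms by (rule relator_subgroup_normal)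
  let ?p = "\<lambda>x. relator_subgroup S R #>\<^bsub>free_group S\<^esub> x"
  have "?p \<in> hom (free_group S) (presented_group S R)"
    unfolding presented_group_def by (rule N.r_coset_hom_Mod)
  moreover have "?p ` carrier (free_group S) = carrier (presented_group S R)"
    unfolding presented_group_def carrier_FactGroup ..
  moreover have "?p (word_class S r) = \<one>\<^bsub>presented_group S R\<^esub>" if "r \<in> R" for r
  proof -
    have "word_class S r \<in> relator_subgroup S R"
      using that by (auto simp: relator_subgroup_def normal_closure_def)
    then show ?thesis
      unfolding presented_group_def by (simp add: F.coset_join2 N.subgroup_axioms)
  qed
  ultimately show thesis using that[of ?p] by (simp add: presented_gen_def)
qed

text \<open>Evaluating a word at the free generators gives its own class. Together with \<open>eval_word_hom\<close>
this turns relators and generating sets of the free group into those of a presented group.\<close>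
lemma word_class_eval:
  "w \<in> words S \<Longrightarrow> eval_word (free_group S) (\<lambda>x. word_class S [(x, True)]) w = word_class S w"
proof (induction w)
  case (Cons a w)
  obtain x b where a: "a = (x, b)" by force
  interpret F: group "free_group S" by (rule group_free_group)
  have x: "x \<in> S" using Cons a by auto
  have "(word_class S [(x, False)]) \<otimes>\<^bsub>free_group S\<^esub> (word_class S [(x, True)]) = \<one>\<^bsub>free_group S\<^esub>"
    using x free_cong.cancel[of "[]" S "[]" x False]
    by (simp add: mult_free_group one_free_group word_class_eq_iff)
  then have "inv\<^bsub>free_group S\<^esub> (word_class S [(x, True)]) = word_class S [(x, False)]"
    using x by (intro F.inv_equality) (auto simp: carrier_free_group)
  then show ?case using Cons x a by (simp add: mult_free_group)
qed (simp add: one_free_group)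

lemma presented_gen_closed:
  assumes "R \<subseteq> words S" "x \<in> S"
  shows "presented_gen S R x \<in> carrier (presented_group S R)"
proof -
  obtain p where p: "p \<in> hom (free_group S) (presented_group S R)"
    "p ` carrier (free_group S) = carrier (presented_group S R)"
    "\<And>x. p (word_class S [(x, True)]) = presented_gen S R x"
    "\<And>r. r \<in> R \<Longrightarrow> p (word_class S r) = \<one>\<^bsub>presented_group S R\<^esub>"
    by (rule presented_group_proj[OF assms(1)]) (rule that)
  have "word_class S [(x, True)] \<in> carrier (free_group S)"
    using assms(2) by (simp add: carrier_free_group)
  from hom_in_carrier[OF p(1) this] show ?thesis by (simp only: p(3))
qed

lemma presented_group_relation:
  assumes "R \<subseteq> words S" "r \<in> R"
  shows "eval_word (presented_group S R) (presented_gen S R) r = \<one>\<^bsub>presented_group S R\<^esub>"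
proof -
  interpret F: group "free_group S" by (rule group_free_group)
  obtain p where p: "p \<in> hom (free_group S) (presented_group S R)"
    "p ` carrier (free_group S) = carrier (presented_group S R)"
    "\<And>x. p (word_class S [(x, True)]) = presented_gen S R x"
    "\<And>r. r \<in> R \<Longrightarrow> p (word_class S r) = \<one>\<^bsub>presented_group S R\<^esub>"
    by (rule presented_group_proj[OF assms(1)]) (rule that)
  have "p (eval_word (free_group S) (\<lambda>x. word_class S [(x, True)]) r) =
      eval_word (presented_group S R) (presented_gen S R) r"
    using assms p(1,3) F.eval_word_hom[of "presented_group S R" p "\<lambda>x. word_class S [(x, True)]" S r]
      group_presented_group[OF assms(1)] by (auto simp: carrier_free_group Pi_iff)
  then show ?thesis using assms p(4) word_class_eval[of r S] by auto
qed

lemma (in group) eval_word_generate: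
  "w \<in> words S \<Longrightarrow> eval_word G f w \<in> generate G (f ` S)"
proof (induction w)
  case (Cons a w)
  obtain x b where a: "a = (x, b)" by force
  then have "f x \<in> f ` S" using Cons.prems by simp
  then show ?case
    using Cons a by (auto intro: generate.intros)
qed (simp add: generate.one)

lemma presented_group_generated:
  assumes "R \<subseteq> words S"
  shows "generate (presented_group S R) (presented_gen S R ` S) = carrier (presented_group S R)"
proof -
  interpret F: group "free_group S" by (rule group_free_group)
  interpret P: group "presented_group S R" using assms by (rule group_presented_group)
  obtain p where p: "p \<in> hom (free_group S) (presented_group S R)"
    "p ` carrier (free_group S) = carrier (presented_group S R)"
    "\<And>x. p (word_class S [(x, True)]) = presented_gen S R x"
    "\<And>r. r \<in> R \<Longrightarrow> p (word_class S r) = \<one>\<^bsub>presented_group S R\<^esub>"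
    by (rule presented_group_proj[OF assms(1)]) (rule that)
  have sub: "presented_gen S R ` S \<subseteq> carrier (presented_group S R)"
    using presented_gen_closed[OF assms] by blast
  have "p (word_class S w) \<in> generate (presented_group S R) (presented_gen S R ` S)"
    if w: "w \<in> words S" for w
  proof -
    have "p (word_class S w) = eval_word (presented_group S R) (presented_gen S R) w"
      using w p(1,3) F.eval_word_hom[of "presented_group S R" p "\<lambda>x. word_class S [(x, True)]" S w]
        P.group_axioms word_class_eval[of w S] by (auto simp: carrier_free_group Pi_iff)
    then show ?thesis using P.eval_word_generate[OF w] by simp
  qed
  then have "carrier (presented_group S R) \<subseteq> generate (presented_group S R) (presented_gen S R ` S)"
    unfolding p(2)[symmetric] carrier_free_group by blast
  then show ?thesis using P.generate_incl[OF sub] by blast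
qed


section \<open>Relations, test homomorphisms and retractions of right-angled Coxeter groups\<close>

text \<open>Total bijections of a type, rather than extensional bijections of a carrier: all test groups
below act on whole types, which avoids restricting every function to a carrier.\<close>
definition perms :: "('b \<Rightarrow> 'b) monoid" where
  "perms = \<lparr>carrier = {f. bij f}, monoid.mult = (\<circ>), one = id\<rparr>"

lemma perms_simps [simp]:
  "f \<in> carrier perms \<longleftrightarrow> bij f" "f \<otimes>\<^bsub>perms\<^esub> g = f \<circ> g" "\<one>\<^bsub>perms\<^esub> = id"
  by (auto simp: perms_def)

lemma group_perms: "group (perms :: ('b \<Rightarrow> 'b) monoid)"
proof (rule groupI)
  fix f :: "'b \<Rightarrow> 'b" assume "f \<in> carrier perms"
  then show "\<exists>g\<in>carrier perms. g \<otimes>\<^bsub>perms\<^esub> f = \<one>\<^bsub>perms\<^esub>"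
    by (intro bexI[of _ "inv_into UNIV f"]) (auto simp: bij_imp_bij_inv bij_is_inj)
qed (auto simp: bij_comp comp_assoc)

lemma bij_involution: "f \<circ> f = id \<Longrightarrow> bij f"
  using o_bij by blast

lemma hom_eq_on_generate:
  assumes "group G" "group H" "h \<in> hom G H" "k \<in> hom G H" "A \<subseteq> carrier G"
    and "\<And>x. x \<in> A \<Longrightarrow> h x = k x" and "x \<in> generate G A"
  shows "h x = k x"
proof -
  interpret h: group_hom G H h using assms by (simp add: group_hom_def group_hom_axioms_def)
  interpret k: group_hom G H k using assms by (simp add: group_hom_def group_hom_axioms_def)
  show ?thesis
    using assms(7)
  proof induction
    case (eng x y)
    then show ?case using assms(5) h.G.generate_in_carrier by simp
  qed (use assms(5,6) in auto)
qed

text \<open>The group and its generators are locale parameters fixed by equations, so that the implicit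
structure notation of groups applies to the Coxeter group.\<close>
locale right_angled = group W for W (structure) +
  fixes V :: "'a set" and E :: "'a set set" and s :: "'a \<Rightarrow> 'a word set set"
  assumes graph: "finite_simplicial_graph V E"
    and W_eq: "W = racg V E"
    and s_eq: "s = presented_gen V (racg_relators V E)"
begin

lemma finite_V: "finite V"
  using graph by (simp add: finite_simplicial_graph_def)

lemma relators_words: "racg_relators V E \<subseteq> words V"
  by (auto simp: racg_relators_def)

lemma s_closed [simp]: "v \<in> V \<Longrightarrow> s v \<in> carrier W"
  unfolding W_eq s_eq racg_def using relators_words by (rule presented_gen_closed)

lemma s_image: "A \<subseteq> V \<Longrightarrow> s ` A \<subseteq> carrier W"
  by auto

lemma generate_V: "generate W (s ` V) = carrier W"
  unfolding W_eq s_eq racg_def using relators_words by (rule presented_group_generated)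

lemma relation: "r \<in> racg_relators V E \<Longrightarrow> eval_word W s r = \<one>"
  unfolding W_eq s_eq racg_def using relators_words by (rule presented_group_relation)

lemma s_square [simp]: "v \<in> V \<Longrightarrow> s v \<otimes> s v = \<one>"
  using relation[of "[(v, True), (v, True)]"] by (auto simp: racg_relators_def)

lemma s_inv [simp]: "v \<in> V \<Longrightarrow> inv (s v) = s v"
  by (rule inv_equality) auto

lemma s_comm: 
  assumes "{v, w} \<in> E" "v \<in> V" "w \<in> V"
  shows "s v \<otimes> s w = s w \<otimes> s v"
proof -
  have "s v \<otimes> (s w \<otimes> (s v \<otimes> s w)) = \<one>"
    using assms relation[of "[(v, True), (w, True), (v, False), (w, False)]"]
    by (auto simp: racg_relators_def)
  then have "(s v \<otimes> s w) \<otimes> (s v \<otimes> s w) = \<one>"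
    using assms by (simp add: m_assoc)
  then have "s v \<otimes> s w = inv (s v \<otimes> s w)"
    using assms by (simp add: inv_equality)
  then show ?thesis
    using assms by (simp add: inv_mult_group)
qed

lemma universal:
  assumes "group H" "\<And>v. v \<in> V \<Longrightarrow> f v \<in> carrier H"
    and "\<And>v. v \<in> V \<Longrightarrow> f v \<otimes>\<^bsub>H\<^esub> f v = \<one>\<^bsub>H\<^esub>"
    and "\<And>v w. {v, w} \<in> E \<Longrightarrow> v \<in> V \<Longrightarrow> w \<in> V \<Longrightarrow> v \<noteq> w \<Longrightarrow>
      f v \<otimes>\<^bsub>H\<^esub> f w = f w \<otimes>\<^bsub>H\<^esub> f v"
  obtains h where "h \<in> hom W H" "\<And>v. v \<in> V \<Longrightarrow> h (s v) = f v"
proof -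
  interpret H: group H by fact
  have inv: "inv\<^bsub>H\<^esub> f v = f v" if "v \<in> V" for v
    using that assms(2,3) by (intro H.inv_equality) auto
  have "eval_word H f r = \<one>\<^bsub>H\<^esub>" if r: "r \<in> racg_relators V E" for r
  proof -
    consider v where "v \<in> V" "r = [(v, True), (v, True)]"
      | v w where "v \<in> V" "w \<in> V" "{v, w} \<in> E" "r = [(v, True), (w, True), (v, False), (w, False)]"
      using r unfolding racg_relators_def by blast
    then show ?thesis
    proof cases
      case 2
      have comm: "f v \<otimes>\<^bsub>H\<^esub> f w = f w \<otimes>\<^bsub>H\<^esub> f v"
        using assms(4)[of v w] 2 by fastforce
      have "f w \<otimes>\<^bsub>H\<^esub> (f v \<otimes>\<^bsub>H\<^esub> f w) = f v"
        unfolding comm using 2 assms(2,3) by (simp flip: H.m_assoc)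
      then show ?thesis using 2 assms(2,3) by (simp add: inv)
    qed (use assms(2,3) in simp)
  qed
  then show thesis
    using presented_group_universal[OF relators_words \<open>group H\<close>, of f] assms(2) that
    unfolding W_eq s_eq racg_def by (auto simp: Pi_iff)
qed

abbreviation L :: "'a set \<Rightarrow> 'a word set set set" where
  "L A \<equiv> generate W (s ` A)"

lemma special_parabolic_eq: "special_parabolic V E A = L A"
  by (simp add: special_parabolic_def W_eq s_eq)

lemma L_subgroup: "A \<subseteq> V \<Longrightarrow> subgroup (L A) W"
  using generate_is_subgroup s_image by blast

lemma L_carrier: "A \<subseteq> V \<Longrightarrow> x \<in> L A \<Longrightarrow> x \<in> carrier W"
  using generate_in_carrier s_image by blast

text \<open>Sending the generators in \<open>A\<close> to the identity respects the defining relations. The resulting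
endomorphism is the identity on the parabolic subgroup of \<open>V - A\<close>; this separates parabolic
subgroups of disjoint vertex sets and computes intersections of parabolic subgroups.\<close>
lemma retraction:
  obtains \<rho> where "\<rho> \<in> hom W W" "\<And>x. x \<in> L (V - A) \<Longrightarrow> \<rho> x = x"
    "\<And>B x. B \<subseteq> V \<Longrightarrow> x \<in> L B \<Longrightarrow> \<rho> x \<in> L (B - A)"
proof -
  let ?f = "\<lambda>v. if v \<in> A then \<one> else s v"
  have comm: "?f v \<otimes> ?f w = ?f w \<otimes> ?f v" if "{v, w} \<in> E" "v \<in> V" "w \<in> V" for v w
    using s_comm[OF that] that by simp
  obtain \<rho> where \<rho>: "\<rho> \<in> hom W W" "\<And>v. v \<in> V \<Longrightarrow> \<rho> (s v) = (if v \<in> A then \<one> else s v)"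
  proof (rule universal[of W ?f])
    show "?f v \<otimes> ?f w = ?f w \<otimes> ?f v" if "{v, w} \<in> E" "v \<in> V" "w \<in> V" for v w
      using that by (rule comm)
  qed (simp_all add: group_axioms that)
  interpret \<rho>: group_hom W W \<rho>
    using \<rho> by unfold_locales
  have 1: "\<rho> x = x" if "x \<in> L (V - A)" for x
  proof (rule hom_eq_on_generate[of W W \<rho> "\<lambda>x. x" "s ` (V - A)" x])
    show "(\<lambda>x. x) \<in> hom W W" by (simp add: hom_def)
  qed (use \<rho> that group_axioms in auto)
  have 2: "\<rho> x \<in> L (B - A)" if "B \<subseteq> V" "x \<in> L B" for B x
  proof -
    have gen: "\<rho> (s u) \<in> L (B - A)" if "u \<in> B" for u
      using that subsetD[OF \<open>B \<subseteq> V\<close> that] \<rho>(2)[of u]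
      by (cases "u \<in> A") (auto simp: generate.one intro: generate.incl)
    show ?thesis
      using that(2)
    proof induction
      case one
      then show ?case by (simp add: generate.one)
    next
      case (incl x)
      then show ?case using gen that(1) by auto
    next
      case (inv x)
      then show ?case using gen that(1) by auto
    next
      case (eng x y)
      then show ?case using L_carrier[OF that(1)] by (auto intro: generate.eng)
    qed
  qed
  show thesis using that[OF \<rho>(1) 1 2] .
qed

lemma L_disjoint:
  assumes "A \<subseteq> V" "B \<subseteq> V" "A \<inter> B = {}" "x \<in> L A" "x \<in> L B"
  shows "x = \<one>"
proof -
  obtain \<rho> where \<rho>: "\<And>x. x \<in> L (V - A) \<Longrightarrow> \<rho> x = x"
    "\<And>B x. B \<subseteq> V \<Longrightarrow> x \<in> L B \<Longrightarrow> \<rho> x \<in> L (B - A)"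
    by (rule retraction[of A]) (rule that)
  have "B \<subseteq> V - A" using assms by blast
  then have "x \<in> L (V - A)" using assms(5) mono_generate[of "s ` B" "s ` (V - A)"] by blast
  then have "\<rho> x = x" by (rule \<rho>(1))
  moreover have "\<rho> x \<in> L {}" using \<rho>(2)[OF assms(1,4)] by simp
  ultimately show ?thesis using generate_empty by simp
qed

end


section \<open>Conjugates of a generator form a free product\<close>

text \<open>Left multiplication by an involution \<open>c\<close> on reduced words of a free product of groups of
order two. On lists that are not reduced it is the identity, which makes it an involution of the
whole type.\<close>
definition toggle :: "'b \<Rightarrow> 'b list \<Rightarrow> 'b list" where
  "toggle c xs = (if \<not> distinct_adj xs then xs
     else if xs \<noteq> [] \<and> hd xs = c then tl xs else c # xs)"

lemma toggle_toggle [simp]: "toggle c (toggle c xs) = xs"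
  by (cases xs) (auto simp: toggle_def distinct_adj_Cons)

lemma toggle_Cons: "distinct_adj (c # xs) \<Longrightarrow> toggle c xs = c # xs"
  by (auto simp: toggle_def distinct_adj_Cons)

lemma distinct_adj_toggle: "distinct_adj xs \<Longrightarrow> distinct_adj (toggle c xs)"
  by (cases xs) (auto simp: toggle_def distinct_adj_Cons)

lemma set_toggle: "set (toggle c xs) \<subseteq> insert c (set xs)"
  by (cases xs) (auto simp: toggle_def)

lemma map_toggle:
  assumes "inj f"
  shows "map f (toggle c xs) = toggle (f c) (map f xs)"
  using assms
  by (cases xs) (auto simp: toggle_def distinct_adj_map_iff inj_on_subset distinct_adj_Cons hd_map
      dest: injD)

context group
begin

definition listprod :: "'a list \<Rightarrow> 'a" where
  "listprod xs = foldr (\<otimes>) xs \<one>"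

lemma listprod_Nil [simp]: "listprod [] = \<one>"
  and listprod_Cons [simp]: "listprod (x # xs) = x \<otimes> listprod xs"
  by (auto simp: listprod_def)

lemma listprod_closed [simp]: "set xs \<subseteq> carrier G \<Longrightarrow> listprod xs \<in> carrier G"
  by (induction xs) auto

lemma listprod_append:
  "set xs \<subseteq> carrier G \<Longrightarrow> set ys \<subseteq> carrier G \<Longrightarrow> listprod (xs @ ys) = listprod xs \<otimes> listprod ys"
  by (induction xs) (auto simp: m_assoc)

lemma listprod_rev:
  assumes "set xs \<subseteq> carrier G" "\<And>x. x \<in> set xs \<Longrightarrow> x \<otimes> x = \<one>"
  shows "listprod (rev xs) = inv (listprod xs)"
  using assms
proof (induction xs)
  case (Cons x xs)
  then have "inv x = x" using inv_equality by auto
  with Cons show ?case by (simp add: listprod_append inv_mult_group)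
qed simp

lemma listprod_toggle:
  assumes "c \<in> carrier G" "c \<otimes> c = \<one>" "distinct_adj xs" "set xs \<subseteq> carrier G"
  shows "listprod (toggle c xs) = c \<otimes> listprod xs"
  using assms by (cases xs) (auto simp: toggle_def simp flip: m_assoc)

lemma listprod_reduce:
  assumes "set xs \<subseteq> C" "C \<subseteq> carrier G" "\<And>c. c \<in> C \<Longrightarrow> c \<otimes> c = \<one>"
  obtains ys where "distinct_adj ys" "set ys \<subseteq> C" "listprod ys = listprod xs"
  using assms(1)
proof (induction xs arbitrary: thesis)
  case (Cons c xs)
  obtain ys where ys: "distinct_adj ys" "set ys \<subseteq> C" "listprod ys = listprod xs"
    using Cons by auto
  have "distinct_adj (toggle c ys)" "set (toggle c ys) \<subseteq> C" "listprod (toggle c ys) = listprod (c # xs)"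
    using ys Cons.prems(2) assms(2,3) set_toggle[of c ys] listprod_toggle[of c ys]
    by (auto simp: distinct_adj_toggle subset_iff)
  then show ?case by (rule Cons.prems(1))
next
  case Nil
  show ?case by (rule Nil.prems(1)[of "[]"]) simp_all
qed

text \<open>Outside the carrier conjugation is the identity, so that it is a bijection of the whole type
and applies entrywise to lists.\<close>
definition conj_by :: "'a \<Rightarrow> 'a \<Rightarrow> 'a" where
  "conj_by g x = (if x \<in> carrier G then g \<otimes> x \<otimes> inv g else x)"

lemma conj_closed [simp]: "g \<in> carrier G \<Longrightarrow> conj_by g x \<in> carrier G \<longleftrightarrow> x \<in> carrier G"
  by (auto simp: conj_by_def)

lemma conj_one [simp]: "conj_by \<one> = id"
  by (auto simp: conj_by_def)

lemma conj_mult: "g \<in> carrier G \<Longrightarrow> h \<in> carrier G \<Longrightarrow> conj_by (g \<otimes> h) = conj_by g \<circ> conj_by h"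
  by (auto simp: conj_by_def fun_eq_iff inv_mult_group m_assoc)

lemma bij_conj: "g \<in> carrier G \<Longrightarrow> bij (conj_by g)"
  by (rule o_bij[of "conj_by (inv g)"]) (simp_all flip: conj_mult)

lemma conj_of_one [simp]: "g \<in> carrier G \<Longrightarrow> conj_by g \<one> = \<one>"
  by (simp add: conj_by_def)

lemma conj_distrib:
  "g \<in> carrier G \<Longrightarrow> x \<in> carrier G \<Longrightarrow> y \<in> carrier G \<Longrightarrow> conj_by g (x \<otimes> y) = conj_by g x \<otimes> conj_by g y"
  by (simp add: conj_by_def m_assoc inv_solve_left)

lemma conj_listprod:
  "g \<in> carrier G \<Longrightarrow> set xs \<subseteq> carrier G \<Longrightarrow> conj_by g (listprod xs) = listprod (map (conj_by g) xs)"
  by (induction xs) (auto simp: conj_distrib)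

lemma conj_commute:
  "g \<in> carrier G \<Longrightarrow> x \<in> carrier G \<Longrightarrow> conj_by g x \<otimes> g = g \<otimes> x"
  by (simp add: conj_by_def m_assoc)

lemma conj_eq_iff:
  "g \<in> carrier G \<Longrightarrow> x \<in> carrier G \<Longrightarrow> conj_by g x = x \<longleftrightarrow> g \<otimes> x = x \<otimes> g"
  by (simp add: conj_by_def inv_solve_right')

end

context right_angled
begin

text \<open>Only conjugators from the parabolic subgroup of \<open>V - {v}\<close> are admitted: these conjugates are
the free factors of the normal closure of \<open>s v\<close>.\<close>
definition conjugates :: "'a \<Rightarrow> 'a word set set set" where
  "conjugates v = (\<lambda>l. conj_by l (s v)) ` L (V - {v})"

lemma conjugates_closed: "v \<in> V \<Longrightarrow> conjugates v \<subseteq> carrier W"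
  using L_carrier[of "V - {v}"] by (auto simp: conjugates_def)

lemma conjugates_square: "v \<in> V \<Longrightarrow> c \<in> conjugates v \<Longrightarrow> c \<otimes> c = \<one>"
  using L_carrier[of "V - {v}"] by (auto simp: conjugates_def simp flip: conj_distrib)

lemma conjugates_conj:
  assumes "v \<in> V" "l \<in> L (V - {v})" "c \<in> conjugates v"
  shows "conj_by l c \<in> conjugates v"
proof -
  obtain k where k: "k \<in> L (V - {v})" "c = conj_by k (s v)"
    using assms(3) by (auto simp: conjugates_def)
  have "conj_by l c = conj_by (l \<otimes> k) (s v)"
    using k assms(2) L_carrier[of "V - {v}"] by (simp add: conj_mult)
  then show ?thesis
    using k(1) assms(2) by (auto simp: conjugates_def intro: generate.eng)
qed

lemma self_conjugate: "v \<in> V \<Longrightarrow> s v \<in> conjugates v"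
  unfolding conjugates_def by (rule image_eqI[of _ _ \<one>]) (auto intro: generate.one)

text \<open>The action of \<open>W\<close> on reduced lists. If \<open>u\<close> is adjacent to \<open>v\<close>, then \<open>s u\<close> fixes the letter
\<open>s v\<close> and so conjugation of all entries commutes with toggling \<open>s v\<close>; the relations between the
other vertices hold because conjugation is an action. A conjugate \<open>c\<close> of \<open>s v\<close> then acts by
toggling \<open>c\<close>.\<close>
lemma reduced_action:
  assumes v: "v \<in> V"
  obtains \<Phi> where "\<Phi> \<in> hom W perms" "\<And>l. l \<in> L (V - {v}) \<Longrightarrow> \<Phi> l = map (conj_by l)"
    "\<And>c. c \<in> conjugates v \<Longrightarrow> \<Phi> c = toggle c"
proof -
  define f where "f u = (if u = v then toggle (s v) else map (conj_by (s u)))" for u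
  have sq: "f u \<circ> f u = id" if "u \<in> V" for u
    using that by (auto simp: f_def fun_eq_iff simp flip: conj_mult)
  have comm: "f u \<circ> f w = f w \<circ> f u" if "{u, w} \<in> E" "u \<in> V" "w \<in> V" "u \<noteq> w" for u w
  proof -
    have *: "map (conj_by (s u)) \<circ> toggle (s v) = toggle (s v) \<circ> map (conj_by (s u))"
      if "{u, v} \<in> E" "u \<in> V" for u
    proof -
      have "conj_by (s u) (s v) = s v"
        using that v s_comm[of u v] by (simp add: conj_eq_iff)
      then show ?thesis
        using that v by (simp add: fun_eq_iff map_toggle bij_conj bij_is_inj)
    qed
    consider "u = v" | "w = v" | "u \<noteq> v" "w \<noteq> v" by blast
    then show ?thesis
    proof cases
      case 1
      then show ?thesis using *[of w] that by (simp add: f_def insert_commute)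
    next
      case 2
      then show ?thesis using *[of u] that by (simp add: f_def)
    next
      case 3
      have "conj_by (s u) \<circ> conj_by (s w) = conj_by (s w) \<circ> conj_by (s u)"
        using that s_comm[of u w] by (simp flip: conj_mult)
      then show ?thesis
        using 3 by (simp add: f_def fun_eq_iff)
    qed
  qed
  obtain \<Phi> where \<Phi>: "\<Phi> \<in> hom W perms" "\<And>u. u \<in> V \<Longrightarrow> \<Phi> (s u) = f u"
  proof (rule universal[of perms f])
    show "f u \<otimes>\<^bsub>perms\<^esub> f w = f w \<otimes>\<^bsub>perms\<^esub> f u" if "{u, w} \<in> E" "u \<in> V" "w \<in> V" "u \<noteq> w" for u w
      using comm[OF that] by simp
  qed (use sq bij_involution in \<open>auto simp: group_perms that\<close>)
  interpret \<Phi>: group_hom W perms \<Phi>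
    using \<Phi>(1) group_perms by (simp add: group_hom_def group_hom_axioms_def group_axioms)
  note Lc = L_carrier[of "V - {v}", OF Diff_subset]
  have \<Phi>L: "\<Phi> l = map (conj_by l)" if "l \<in> L (V - {v})" for l
    using that
  proof induction
    case one
    then show ?case by (simp add: fun_eq_iff)
  next
    case (incl x)
    then show ?case using \<Phi>(2) by (auto simp: f_def)
  next
    case (inv x)
    then show ?case using \<Phi>(2) by (auto simp: f_def)
  next
    case (eng x y)
    then show ?case using Lc by (simp add: conj_mult comp_def)
  qed
  have "\<Phi> c = toggle c" if c: "c \<in> conjugates v" for c
  proof -
    obtain l where l: "l \<in> L (V - {v})" "c = conj_by l (s v)"
      using c by (auto simp: conjugates_def)
    have "\<Phi> c \<circ> \<Phi> l = \<Phi> l \<circ> \<Phi> (s v)"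
      using conj_commute[of l "s v"] v l Lc by (metis \<Phi>.hom_mult conj_closed perms_simps(2) s_closed)
    also have "\<dots> = toggle c \<circ> \<Phi> l"
      using l Lc v by (simp add: \<Phi>L \<Phi>(2) f_def fun_eq_iff map_toggle bij_conj bij_is_inj)
    finally have "\<Phi> c \<circ> \<Phi> l = toggle c \<circ> \<Phi> l" .
    moreover have "surj (\<Phi> l)"
      using \<Phi>.hom_closed[of l] l Lc bij_is_surj by auto
    ultimately show ?thesis
      by (metis surj_fun_eq comp_apply ext surjE)
  qed
  with that \<Phi>(1) \<Phi>L show thesis by blast
qed

text \<open>The conjugates of \<open>s v\<close> generate their free product: the action sends the empty list to the
reduced list itself, which can therefore be read off from the product.\<close>
lemma reduced_unique:
  assumes v: "v \<in> V"
    and "distinct_adj cs" "set cs \<subseteq> conjugates v" "distinct_adj ds" "set ds \<subseteq> conjugates v"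
    and "listprod cs = listprod ds"
  shows "cs = ds"
proof -
  obtain \<Phi> where \<Phi>: "\<Phi> \<in> hom W perms" "\<And>c. c \<in> conjugates v \<Longrightarrow> \<Phi> c = toggle c"
    by (rule reduced_action[OF v]) (rule that)
  interpret \<Phi>: group_hom W perms \<Phi>
    using \<Phi>(1) group_perms by (simp add: group_hom_def group_hom_axioms_def group_axioms)
  have *: "\<Phi> (listprod cs) [] = cs" if "distinct_adj cs" "set cs \<subseteq> conjugates v" for cs
    using that
  proof (induction cs)
    case (Cons c cs)
    then have "set (c # cs) \<subseteq> carrier W" "distinct_adj cs"
      using conjugates_closed[OF v] by (auto dest: distinct_adj_ConsD)
    with Cons show ?case by (simp add: \<Phi>(2) toggle_Cons)
  qed simp
  have "cs = \<Phi> (listprod ds) []"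
    using *[OF assms(2,3)] by (simp only: assms(6))
  also have "\<dots> = ds"
    using assms(4,5) by (rule *)
  finally show ?thesis .
qed

text \<open>\<open>W\<close> is the semidirect product of the normal closure of \<open>s v\<close> and the parabolic subgroup of
\<open>V - {v}\<close>.\<close>
lemma normal_form:
  assumes v: "v \<in> V" and g: "g \<in> carrier W"
  obtains cs l where "distinct_adj cs" "set cs \<subseteq> conjugates v" "l \<in> L (V - {v})" "g = listprod cs \<otimes> l"
proof -
  note Lc = L_carrier[of "V - {v}", OF Diff_subset]
  note Cc = conjugates_closed[OF v]
  have "\<exists>cs l. set cs \<subseteq> conjugates v \<and> l \<in> L (V - {v}) \<and> g = listprod cs \<otimes> l"
    using g[folded generate_V]
  proof induction
    case one
    show ?case by (rule exI[of _ "[]"], rule exI[of _ \<one>]) (auto intro: generate.one)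
  next
    case (incl x)
    then obtain u where u: "u \<in> V" "x = s u" by auto
    show ?case
    proof (cases "u = v")
      case True
      then show ?thesis using u self_conjugate[OF v]
        by (intro exI[of _ "[s v]"] exI[of _ \<one>]) (simp add: generate.one)
    next
      case False
      then show ?thesis using u
        by (intro exI[of _ "[]"] exI[of _ "s u"]) (simp add: generate.incl)
    qed
  next
    case (inv x)
    then obtain u where u: "u \<in> V" "x = s u" by auto
    show ?case
    proof (cases "u = v")
      case True
      then show ?thesis using u self_conjugate[OF v]
        by (intro exI[of _ "[s v]"] exI[of _ \<one>]) (simp add: generate.one)
    next
      case False
      then show ?thesis using u
        by (intro exI[of _ "[]"] exI[of _ "s u"]) (simp add: generate.incl)
    qed
  next
    case (eng x y)
    then obtain cs l ds k where x: "set cs \<subseteq> conjugates v" "l \<in> L (V - {v})" "x = listprod cs \<otimes> l"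
      and y: "set ds \<subseteq> conjugates v" "k \<in> L (V - {v})" "y = listprod ds \<otimes> k"
      by blast
    have c: "set cs \<subseteq> carrier W" "set ds \<subseteq> carrier W" "l \<in> carrier W" "k \<in> carrier W"
      using x y Cc Lc by auto
    have m: "set (map (conj_by l) ds) \<subseteq> conjugates v"
      using conjugates_conj[OF v x(2)] y(1) by auto
    have "x \<otimes> y = listprod cs \<otimes> ((l \<otimes> listprod ds) \<otimes> k)"
      using x y c by (simp add: m_assoc)
    also have "l \<otimes> listprod ds = conj_by l (listprod ds) \<otimes> l"
      using c by (simp add: conj_commute)
    also have "listprod cs \<otimes> (conj_by l (listprod ds) \<otimes> l \<otimes> k) =
        listprod (cs @ map (conj_by l) ds) \<otimes> (l \<otimes> k)"
      using c listprod_append[OF c(1) order.trans[OF m Cc]]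
        listprod_closed[OF order.trans[OF m Cc]]
      by (simp add: m_assoc conj_listprod)
    finally have "x \<otimes> y = listprod (cs @ map (conj_by l) ds) \<otimes> (l \<otimes> k)" .
    then show ?case
      using x(1,2) y(2) m by (intro exI[of _ "cs @ map (conj_by l) ds"] exI[of _ "l \<otimes> k"])
        (auto intro: generate.eng)
  qed
  then obtain cs l where cs: "set cs \<subseteq> conjugates v" and l: "l \<in> L (V - {v})" "g = listprod cs \<otimes> l"
    by blast
  obtain ds where "distinct_adj ds" "set ds \<subseteq> conjugates v" "listprod ds = listprod cs"
    using listprod_reduce[OF cs Cc] conjugates_square[OF v] by blast
  with l that show thesis by simp
qed

end


section \<open>Free subgroups of rank two\<close>

definition freely_reduced :: "'a word \<Rightarrow> bool" where
  "freely_reduced = successively (\<lambda>p q. fst p = fst q \<longrightarrow> snd p = snd q)"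

lemma freely_reduced_simps [simp]:
  "freely_reduced []" "freely_reduced [p]"
  "freely_reduced (p # q # w) \<longleftrightarrow> (fst p = fst q \<longrightarrow> snd p = snd q) \<and> freely_reduced (q # w)"
  by (auto simp: freely_reduced_def)

lemma freely_reduced_exists:
  assumes "w \<in> words S"
  shows "\<exists>u. freely_reduced u \<and> (w, u) \<in> free_cong S"
  using assms
proof (induction w)
  case Nil
  show ?case by (rule exI[of _ "[]"]) (simp add: free_cong.refl)
next
  case (Cons p w)
  obtain x b where p: "p = (x, b)" by force
  have x: "x \<in> S" "w \<in> words S" using Cons.prems p by auto
  then obtain u where u: "freely_reduced u" "(w, u) \<in> free_cong S"
    using Cons.IH by blast
  have pu: "(p # w, p # u) \<in> free_cong S"
    using free_cong_append_left[OF u(2), of "[p]"] p x by simp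
  show ?case
  proof (cases "\<exists>t. u = (x, \<not> b) # t")
    case True
    then obtain t where t: "u = (x, \<not> b) # t" by blast
    have "t \<in> words S" using free_cong_words[OF u(2)] t by simp
    then have "(p # u, t) \<in> free_cong S"
      using free_cong.cancel[of "[]" S t x b] x t p by simp
    moreover have "freely_reduced t"
      using u(1) t by (cases t) auto
    ultimately show ?thesis using pu free_cong.trans by blast
  next
    case False
    then have "freely_reduced (p # u)"
      using u(1) p by (cases u) auto
    then show ?thesis using pu by blast
  qed
qed

text \<open>A free group maps to \<open>G\<close> by evaluation of words, and every element of it is the class of a
freely reduced word.\<close>
lemma (in group) full_sizedI:
  assumes f: "\<And>i :: bool. f i \<in> carrier G"
    and nontriv: "\<And>w. freely_reduced w \<Longrightarrow> w \<noteq> [] \<Longrightarrow> eval_word G f w \<noteq> \<one>"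
  shows "full_sized G"
proof -
  let ?F = "free_group (UNIV :: bool set)"
  have fS: "f \<in> UNIV \<rightarrow> carrier G" using f by simp
  obtain h where h: "h \<in> hom ?F G"
    "\<And>w. w \<in> words UNIV \<Longrightarrow> h (word_class UNIV w) = eval_word G f w"
    using free_group_universal[OF group_axioms fS] by blast
  interpret h: group_hom ?F G h
    using h(1) by (simp add: group_hom_def group_hom_axioms_def group_free_group group_axioms)
  have "X = \<one>\<^bsub>?F\<^esub>" if X: "X \<in> carrier ?F" "h X = \<one>" for X
  proof -
    obtain w where w: "w \<in> words UNIV" "X = word_class UNIV w"
      using X(1) by (auto simp: carrier_free_group)
    obtain u where u: "freely_reduced u" "(w, u) \<in> free_cong UNIV"
      using freely_reduced_exists[OF w(1)] by blast
    have "eval_word G f u = \<one>"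
      using X(2) w h(2) eval_word_free_cong[OF fS u(2)] by simp
    then have "u = []" using nontriv u(1) by blast
    then show ?thesis
      using u(2) w by (simp add: one_free_group word_class_eq_iff)
  qed
  then have "inj_on h (carrier ?F)"
    using h.inj_iff_trivial_ker by (auto simp: kernel_def)
  then have "h \<in> iso ?F (G\<lparr>carrier := h ` carrier ?F\<rparr>)"
    by (auto simp: iso_def hom_def bij_betw_def)
  moreover have "subgroup (h ` carrier ?F) G"
    by (rule h.img_is_subgroup)
  ultimately show ?thesis
    unfolding full_sized_def is_iso_def by blast
qed

lemma (in group) eval_word_consistent:
  assumes "subgroup N G" "\<And>x. f x \<in> N"
  shows "eval_word (G\<lparr>carrier := N\<rparr>) f w = eval_word G f w"
  using assms by (induction w) (auto simp: m_inv_consistent)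

lemma (in group) power_in_finite_index:
  assumes A: "subgroup A G" "finite (rcosets A)" and x: "x \<in> carrier G"
  obtains n :: nat where "n > 0" "x [^] n \<in> A"
proof -
  have "\<not> inj (\<lambda>k :: nat. A #> x [^] k)"
  proof
    assume "inj (\<lambda>k :: nat. A #> x [^] k)"
    then have "infinite (range (\<lambda>k :: nat. A #> x [^] k))"
      using finite_imageD by blast
    moreover have "range (\<lambda>k :: nat. A #> x [^] k) \<subseteq> rcosets A"
      using x by (auto simp: RCOSETS_def)
    ultimately show False using A(2) finite_subset by blast
  qed
  then obtain i j :: nat where ij: "i < j" "A #> x [^] i = A #> x [^] j"
    unfolding inj_def by (metis linorder_neqE_nat)
  have "x [^] j \<in> A #> x [^] i"
    using rcos_self[of "x [^] j" A] A(1) x ij(2) by simp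
  then obtain a where a: "a \<in> A" "x [^] j = a \<otimes> x [^] i"
    by (auto simp: r_coset_def)
  have "x [^] (j - i) \<otimes> x [^] i = a \<otimes> x [^] i"
    using a(2) ij(1) x by (simp add: nat_pow_mult)
  then have "x [^] (j - i) = a"
    using x a(1) subgroup.mem_carrier[OF A(1)] by simp
  then show thesis using that[of "j - i"] ij(1) a(1) by simp
qed

text \<open>The translation \<open>(a, b) \<mapsto> (a + 1, b)\<close> and the shear \<open>(a, b) \<mapsto> (a, b + a)\<close> generate the
integral Heisenberg group, in which the commutator of \<open>p\<close>-th and \<open>q\<close>-th powers is the \<open>p q\<close>-th
power of a central element of infinite order.\<close>
lemma free_powers_not_commute:
  fixes x y :: "'a"
  assumes xy: "x \<in> S" "y \<in> S" "x \<noteq> y" and pq: "p > (0 :: nat)" "q > (0 :: nat)"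
  defines "F \<equiv> free_group S" and "X \<equiv> word_class S [(x, True)]" and "Y \<equiv> word_class S [(y, True)]"
  shows "X [^]\<^bsub>F\<^esub> p \<otimes>\<^bsub>F\<^esub> Y [^]\<^bsub>F\<^esub> q \<noteq> Y [^]\<^bsub>F\<^esub> q \<otimes>\<^bsub>F\<^esub> X [^]\<^bsub>F\<^esub> p"
proof
  assume eq: "X [^]\<^bsub>F\<^esub> p \<otimes>\<^bsub>F\<^esub> Y [^]\<^bsub>F\<^esub> q = Y [^]\<^bsub>F\<^esub> q \<otimes>\<^bsub>F\<^esub> X [^]\<^bsub>F\<^esub> p"
  let ?P = "perms :: (int \<times> int \<Rightarrow> int \<times> int) monoid"
  define f :: "'a \<Rightarrow> int \<times> int \<Rightarrow> int \<times> int" where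
    "f z = (if z = x then (\<lambda>(a, b). (a + 1, b)) else (\<lambda>(a, b). (a, b + a)))" for z
  have "bij (\<lambda>(a :: int, b :: int). (a + 1, b))"
    by (rule o_bij[of "\<lambda>(a, b). (a - 1, b)"]) auto
  moreover have "bij (\<lambda>(a :: int, b :: int). (a, b + a))"
    by (rule o_bij[of "\<lambda>(a, b). (a, b - a)"]) auto
  ultimately have f: "f \<in> S \<rightarrow> carrier ?P" by (auto simp: f_def)
  obtain h where h: "h \<in> hom F ?P"
    "\<And>w. w \<in> words S \<Longrightarrow> h (word_class S w) = eval_word ?P f w"
    unfolding F_def using free_group_universal[OF group_perms f] by blast
  interpret h: group_hom F ?P h
    using h(1)
    by (simp add: group_hom_def group_hom_axioms_def F_def group_free_group group_perms)
  have XY: "X \<in> carrier F" "Y \<in> carrier F"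
    using xy by (auto simp: F_def X_def Y_def carrier_free_group)
  have hX: "h (X [^]\<^bsub>F\<^esub> n) (a, b) = (a + int n, b)" for n :: nat and a b
    using XY xy h(2)[of "[(x, True)]"]
    by (induction n arbitrary: a b) (auto simp: f_def X_def)
  have hY: "h (Y [^]\<^bsub>F\<^esub> n) (a, b) = (a, b + int n * a)" for n :: nat and a b
    using XY xy h(2)[of "[(y, True)]"]
    by (induction n arbitrary: a b) (auto simp: f_def Y_def algebra_simps)
  have hm: "h (A \<otimes>\<^bsub>F\<^esub> B) (0, 0) = h A (h B (0, 0))" if "A \<in> carrier F" "B \<in> carrier F" for A B
    using that by simp
  have "h (X [^]\<^bsub>F\<^esub> p \<otimes>\<^bsub>F\<^esub> Y [^]\<^bsub>F\<^esub> q) (0, 0) = (int p, 0)"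
    using XY by (subst hm) (simp_all only: h.G.nat_pow_closed hX hY, simp)
  moreover have "h (Y [^]\<^bsub>F\<^esub> q \<otimes>\<^bsub>F\<^esub> X [^]\<^bsub>F\<^esub> p) (0, 0) = (int p, int q * int p)"
    using XY by (subst hm) (simp_all only: h.G.nat_pow_closed hX hY, simp)
  ultimately show False using eq pq by simp
qed

text \<open>A subgroup of finite index contains a positive power of every element, so that some positive
powers of two free generators would commute.\<close>
lemma virtually_abelian_not_full_sized:
  assumes "group G" "virtually_abelian G"
  shows "\<not> full_sized G"
proof
  assume "full_sized G"
  let ?F = "free_group (UNIV :: bool set)"
  interpret G: group G by fact
  interpret F: group ?F by (rule group_free_group)
  obtain H \<phi> where H: "subgroup H G" and \<phi>: "\<phi> \<in> iso ?F (G\<lparr>carrier := H\<rparr>)"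
    using \<open>full_sized G\<close> by (auto simp: full_sized_def is_iso_def)
  have "\<phi> \<in> hom ?F G"
    using \<phi> subgroup.subset[OF H] by (auto simp: iso_def hom_def)
  then interpret \<phi>: group_hom ?F G \<phi> by unfold_locales
  have inj: "inj_on \<phi> (carrier ?F)"
    using \<phi> by (auto simp: iso_def bij_betw_def)
  obtain A where A: "subgroup A G" "comm_group (G\<lparr>carrier := A\<rparr>)" "finite (rcosets\<^bsub>G\<^esub> A)"
    using assms(2) by (auto simp: virtually_abelian_def)
  let ?X = "word_class (UNIV :: bool set) [(True, True)]"
  let ?Y = "word_class (UNIV :: bool set) [(False, True)]"
  have XY: "?X \<in> carrier ?F" "?Y \<in> carrier ?F"
    by (auto simp: carrier_free_group)
  obtain p :: nat where p: "p > 0" "\<phi> ?X [^]\<^bsub>G\<^esub> p \<in> A"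
    using G.power_in_finite_index[OF A(1,3), of "\<phi> ?X"] XY by auto
  obtain q :: nat where q: "q > 0" "\<phi> ?Y [^]\<^bsub>G\<^esub> q \<in> A"
    using G.power_in_finite_index[OF A(1,3), of "\<phi> ?Y"] XY by auto
  have "\<phi> ?X [^]\<^bsub>G\<^esub> p \<otimes>\<^bsub>G\<^esub> \<phi> ?Y [^]\<^bsub>G\<^esub> q = \<phi> ?Y [^]\<^bsub>G\<^esub> q \<otimes>\<^bsub>G\<^esub> \<phi> ?X [^]\<^bsub>G\<^esub> p"
    using comm_monoid.m_comm[OF comm_group.axioms(1)[OF A(2)]] p(2) q(2) by simp
  then have "\<phi> (?X [^]\<^bsub>?F\<^esub> p \<otimes>\<^bsub>?F\<^esub> ?Y [^]\<^bsub>?F\<^esub> q) = \<phi> (?Y [^]\<^bsub>?F\<^esub> q \<otimes>\<^bsub>?F\<^esub> ?X [^]\<^bsub>?F\<^esub> p)"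
    using XY by (simp add: \<phi>.hom_nat_pow)
  then have "?X [^]\<^bsub>?F\<^esub> p \<otimes>\<^bsub>?F\<^esub> ?Y [^]\<^bsub>?F\<^esub> q = ?Y [^]\<^bsub>?F\<^esub> q \<otimes>\<^bsub>?F\<^esub> ?X [^]\<^bsub>?F\<^esub> p"
    using XY inj by (simp add: inj_on_def)
  then show False
    using free_powers_not_commute[of True UNIV False p q] p(1) q(1) by simp
qed

lemma third_element:
  assumes "card D \<ge> 3"
  shows "\<exists>d\<in>D. d \<noteq> x \<and> d \<noteq> y"
proof (rule ccontr)
  assume "\<not> ?thesis"
  then have "card D \<le> card {x, y}" by (intro card_mono) auto
  also have "\<dots> \<le> 2" by (simp add: card_insert_if)
  finally show False using assms by simp
qed

lemma distinct_adj_concat: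
  assumes "\<And>a. B a \<noteq> []" "\<And>a. distinct_adj (B a)"
    and "successively (\<lambda>a b. last (B a) \<noteq> hd (B b)) w"
  shows "distinct_adj (concat (map B w))"
  using assms(3)
proof (induction w rule: induct_list012)
  case (3 a b w)
  then show ?case using assms(1,2) by (auto simp: distinct_adj_append_iff)
qed (use assms(2) in auto)

context right_angled
begin

text \<open>Framing the given element by a letter \<open>d\<close> different from its first and last letter yields an
element \<open>m\<close> of \<open>M\<close> that begins and ends with \<open>d\<close>. With the three remaining letters \<open>a, b, e\<close> take
\<open>x = (a m a) (b m b)\<close> and \<open>y = m (e m e)\<close>. The reduced words of \<open>x, x\<^sup>-\<^sup>1, y, y\<^sup>-\<^sup>1\<close> begin with
\<open>a, b, d, e\<close> and end with \<open>b, a, e, d\<close>, so a freely reduced word in \<open>x\<close> and \<open>y\<close> becomes a reduced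
list of letters by mere concatenation.\<close>
lemma free_pair:
  assumes v: "v \<in> V" and D: "D \<subseteq> conjugates v" "card D = 4"
    and M: "M \<lhd> W" and cs: "distinct_adj cs" "set cs \<subseteq> conjugates v" "cs \<noteq> []" "listprod cs \<in> M"
  obtains f :: "bool \<Rightarrow> 'a word set set" where "\<And>i. f i \<in> M"
    "\<And>w. freely_reduced w \<Longrightarrow> w \<noteq> [] \<Longrightarrow>
      \<exists>ds. ds \<noteq> [] \<and> distinct_adj ds \<and> set ds \<subseteq> conjugates v \<and> eval_word W f w = listprod ds"
proof -
  interpret M: normal M W by fact
  note Cc = conjugates_closed[OF v]
  obtain d where d: "d \<in> D" "d \<noteq> hd cs" "d \<noteq> last cs"
    using third_element[of D "hd cs" "last cs"] D(2) by auto
  have "card (D - {d}) = 3" using d(1) D(2) by simp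
  then obtain a b e where abe: "D - {d} = {a, b, e}" "a \<noteq> b" "b \<noteq> e" "a \<noteq> e"
    by (auto simp: card_3_iff)
  then have ne: "a \<noteq> d" "b \<noteq> d" "e \<noteq> d" by blast+
  have C: "a \<in> conjugates v" "b \<in> conjugates v" "d \<in> conjugates v" "e \<in> conjugates v"
    using abe(1) d(1) D(1) by blast+
  define ms where "ms = d # cs @ [d]"
  have conj_mem: "listprod (c # xs @ [c]) \<in> M"
    if "c \<in> conjugates v" "set xs \<subseteq> conjugates v" "listprod xs \<in> M" for c xs
  proof -
    have c: "c \<in> carrier W" "c \<otimes> c = \<one>" "set xs \<subseteq> carrier W"
      using that(1,2) Cc conjugates_square[OF v] by auto
    then have "inv c = c" by (simp add: inv_equality)
    then have "listprod (c # xs @ [c]) = c \<otimes> listprod xs \<otimes> inv c"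
      using c by (simp add: listprod_append m_assoc)
    then show ?thesis using M.inv_op_closed2[OF c(1) that(3)] by simp
  qed
  have ms: "distinct_adj ms" "ms \<noteq> []" "hd ms = d" "last ms = d" "set ms \<subseteq> conjugates v"
    "listprod ms \<in> M"
    using cs d C conj_mem[OF C(3) cs(2,4)]
    by (auto simp: ms_def distinct_adj_append_iff distinct_adj_Cons)
  define X where "X i = (if i then (a # ms @ [a]) @ (b # ms @ [b]) else ms @ (e # ms @ [e]))" for i
  have X: "distinct_adj (X i)" "X i \<noteq> []" "set (X i) \<subseteq> conjugates v" for i
    using ms C ne abe by (auto simp: X_def distinct_adj_append_iff distinct_adj_Cons)
  have Xc: "set (X i) \<subseteq> carrier W" for i using X(3) Cc by blast
  have XM: "listprod (X i) \<in> M" for i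
  proof -
    have c: "set (c # ms @ [c]) \<subseteq> carrier W" if "c \<in> conjugates v" for c
      using that ms(5) Cc by auto
    have "set ms \<subseteq> carrier W" using ms(5) Cc by auto
    moreover have "listprod (c # ms @ [c]) \<in> M" if "c \<in> conjugates v" for c
      using that ms(5,6) by (rule conj_mem)
    ultimately show ?thesis
      unfolding X_def using ms(6) C c listprod_append by (simp del: listprod_Cons append_Cons)
  qed
  define B where "B p = (if snd p then X (fst p) else rev (X (fst p)))" for p
  have ends: "hd (B (i, c)) = (if i then if c then a else b else if c then d else e)"
    "last (B (i, c)) = (if i then if c then b else a else if c then e else d)" for i c
    using ms by (auto simp: B_def X_def hd_rev last_rev)
  have B: "distinct_adj (B p)" "B p \<noteq> []" "set (B p) \<subseteq> conjugates v" for p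
    using X[of "fst p"] by (auto simp: B_def)
  have Bc: "set (B p) \<subseteq> carrier W" for p using B(3) Cc by blast
  have Bv: "listprod (B (i, c)) = (if c then listprod (X i) else inv (listprod (X i)))" for i c
    using listprod_rev[OF Xc] conjugates_square[OF v] X(3)[of i] by (auto simp: B_def)
  have fin: "\<exists>ds. ds \<noteq> [] \<and> distinct_adj ds \<and> set ds \<subseteq> conjugates v \<and>
      eval_word W (\<lambda>i. listprod (X i)) w = listprod ds" if w: "freely_reduced w" "w \<noteq> []" for w
  proof (intro exI conjI)
    have "last (B p) \<noteq> hd (B q)" if "fst p = fst q \<longrightarrow> snd p = snd q" for p q
      using that ne abe(2-4) by (cases p; cases q) (auto simp: ends)
    then have "successively (\<lambda>p q. last (B p) \<noteq> hd (B q)) w"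
      using w(1) unfolding freely_reduced_def by (rule successively_mono[rotated]) 
    then show "distinct_adj (concat (map B w))"
      by (intro distinct_adj_concat B)
    show "concat (map B w) \<noteq> []" using w(2) B(2) by (cases w) auto
    show "set (concat (map B w)) \<subseteq> conjugates v" using B(3) by auto
    show "eval_word W (\<lambda>i. listprod (X i)) w = listprod (concat (map B w))"
    proof (induction w)
      case (Cons p w)
      have "set (concat (map B w)) \<subseteq> carrier W" using Bc by auto
      with Cons show ?case using Bc[of p]
        by (cases p) (simp add: listprod_append Bv)
    qed simp
  qed
  show thesis using that[OF XM fin] .
qed

text \<open>For a letter \<open>d\<close> that is neither the first nor the last one, \<open>d # cs\<close> and \<open>cs @ [d]\<close> are
different reduced lists.\<close>
lemma reduced_not_central:
  assumes v: "v \<in> V" and D: "D \<subseteq> conjugates v" "card D \<ge> 3"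
    and cs: "distinct_adj cs" "set cs \<subseteq> conjugates v" "cs \<noteq> []"
  shows "\<exists>d\<in>carrier W. d \<otimes> listprod cs \<noteq> listprod cs \<otimes> d"
proof -
  note Cc = conjugates_closed[OF v]
  obtain d where d: "d \<in> conjugates v" "d \<noteq> hd cs" "d \<noteq> last cs"
    using third_element[of D "hd cs" "last cs"] D by auto
  have dc: "d \<in> carrier W" "set cs \<subseteq> carrier W" using d(1) cs(2) Cc by auto
  have "d # cs \<noteq> cs @ [d]" using d(2) cs(3) by (cases cs) auto
  then have "listprod (d # cs) \<noteq> listprod (cs @ [d])"
    using reduced_unique[OF v, of "d # cs" "cs @ [d]"] cs d
    by (auto simp: distinct_adj_Cons distinct_adj_append_iff)
  then have "d \<otimes> listprod cs \<noteq> listprod cs \<otimes> d"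
    using dc by (simp add: listprod_append)
  then show ?thesis using dc(1) by blast
qed

end


section \<open>The number of conjugates of a generator and the centre\<close>

lemma map_prod_involution:
  assumes "\<alpha> \<circ> \<alpha> = id" shows "map_prod \<alpha> id \<circ> map_prod \<alpha> id = id"
  using assms by (simp add: map_prod_compose[symmetric] prod.map_id0)

text \<open>The involutions of the base of the permutational wreath product of \<open>bool\<close> with permutations
of \<open>'p\<close>: only the second component at position \<open>q\<close> is negated. Permuting the positions by \<open>\<alpha>\<close>
conjugates \<open>flip q\<close> to \<open>flip (\<alpha> q)\<close>.\<close>
definition flip :: "'p \<Rightarrow> 'p \<times> bool \<Rightarrow> 'p \<times> bool" where
  "flip q = (\<lambda>(p, t). (p, t \<noteq> (p = q)))"

lemma flip_flip [simp]: "flip q \<circ> flip q = id"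
  by (auto simp: flip_def fun_eq_iff)

lemma flip_inject [simp]: "flip q = flip r \<longleftrightarrow> q = r"
  by (auto simp: flip_def fun_eq_iff)

lemma map_prod_flip: "inj \<alpha> \<Longrightarrow> map_prod \<alpha> id \<circ> flip q = flip (\<alpha> q) \<circ> map_prod \<alpha> id"
  by (auto simp: flip_def fun_eq_iff dest: injD)

lemma (in group) finite_generate_central_involutions:
  assumes "finite T" "T \<subseteq> carrier G" "\<And>t. t \<in> T \<Longrightarrow> t \<otimes> t = \<one>"
    and "\<And>t x. t \<in> T \<Longrightarrow> x \<in> carrier G \<Longrightarrow> t \<otimes> x = x \<otimes> t"
  shows "finite (generate G T)"
  using assms
proof (induction T)
  case empty
  then show ?case by (simp add: generate_empty)
next
  case (insert t T)
  let ?K = "generate G T"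
  have t: "t \<in> carrier G" "t \<otimes> t = \<one>" "\<And>x. x \<in> carrier G \<Longrightarrow> t \<otimes> x = x \<otimes> t"
    using insert.prems by blast+
  have "inv t = t" using t(1,2) by (simp add: inv_equality)
  have K: "subgroup ?K G" using insert.prems(1) by (intro generate_is_subgroup) simp
  note Kc = subgroup.mem_carrier[OF K]
  have tK: "t \<in> (\<lambda>k. t \<otimes> k) ` ?K"
    by (rule image_eqI[of _ _ \<one>]) (simp_all add: t(1) generate.one)
  have "generate G (insert t T) \<subseteq> ?K \<union> (\<lambda>k. t \<otimes> k) ` ?K"
  proof
    fix x assume "x \<in> generate G (insert t T)"
    then show "x \<in> ?K \<union> (\<lambda>k. t \<otimes> k) ` ?K"
    proof induction
      case one
      show ?case by (simp add: generate.one)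
    next
      case (incl x)
      then show ?case
        using tK by (auto intro: generate.incl)
    next
      case (inv x)
      then show ?case
        using tK \<open>inv t = t\<close> by (auto intro: generate.inv)
    next
      case (eng x y)
      have *: "a \<otimes> (t \<otimes> b) = t \<otimes> (a \<otimes> b)" "t \<otimes> a \<otimes> b = t \<otimes> (a \<otimes> b)"
        "t \<otimes> a \<otimes> (t \<otimes> b) = a \<otimes> b" if "a \<in> ?K" "b \<in> ?K" for a b
      proof -
        have ab: "a \<in> carrier G" "b \<in> carrier G" using that Kc by auto
        show 1: "a \<otimes> (t \<otimes> b) = t \<otimes> (a \<otimes> b)"
          using ab t(1,3) by (metis m_assoc)
        show "t \<otimes> a \<otimes> b = t \<otimes> (a \<otimes> b)"
          using ab t(1) by (simp add: m_assoc)
        show "t \<otimes> a \<otimes> (t \<otimes> b) = a \<otimes> b"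
          using ab t(1,2) 1 by (metis l_one m_assoc m_closed)
      qed
      from eng.IH show ?case
        by (elim UnE imageE) (auto simp: * intro: generate.eng)
    qed
  qed
  moreover have "finite ?K" using insert.prems by (intro insert.IH) blast+
  ultimately show ?case using finite_subset by blast
qed

context right_angled
begin

text \<open>Two nonadjacent vertices act on the integers as reflections with adjacent centres; their
product is a translation and has infinite order.\<close>
lemma dihedral_hom:
  assumes "v \<in> V" "w \<in> V" "v \<noteq> w" "{v, w} \<notin> E"
  obtains \<delta> where "\<delta> \<in> hom W (perms :: (int \<Rightarrow> int) monoid)"
    "\<delta> (s v) = (\<lambda>n. - n)" "\<delta> (s w) = (\<lambda>n. 1 - n)"
proof -
  define f where "f u = (if u = v then (\<lambda>n. - n) else if u = w then (\<lambda>n. 1 - n)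
    else (\<lambda>n :: int. n))" for u
  have inv: "f u \<circ> f u = id" for u by (auto simp: f_def fun_eq_iff)
  obtain \<delta> where "\<delta> \<in> hom W (perms :: (int \<Rightarrow> int) monoid)" "\<And>u. u \<in> V \<Longrightarrow> \<delta> (s u) = f u"
  proof (rule universal[of "perms :: (int \<Rightarrow> int) monoid" f])
    show "f x \<otimes>\<^bsub>perms\<^esub> f y = f y \<otimes>\<^bsub>perms\<^esub> f x" if "{x, y} \<in> E" for x y
      using that assms(4) by (auto simp: f_def fun_eq_iff insert_commute)
  qed (use inv bij_involution in \<open>auto simp: group_perms that\<close>)
  then show thesis
    using that[of \<delta>] assms by (auto simp: f_def)
qed

lemma nonadjacent_not_commute:
  assumes "v \<in> V" "w \<in> V" "v \<noteq> w" "{v, w} \<notin> E"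
  shows "s v \<otimes> s w \<noteq> s w \<otimes> s v"
proof
  assume eq: "s v \<otimes> s w = s w \<otimes> s v"
  obtain \<delta> where \<delta>: "\<delta> \<in> hom W (perms :: (int \<Rightarrow> int) monoid)"
    "\<delta> (s v) = (\<lambda>n. - n)" "\<delta> (s w) = (\<lambda>n. 1 - n)"
    using assms by (rule dihedral_hom)
  have "\<delta> (s v \<otimes> s w) 0 = \<delta> (s w \<otimes> s v) 0" using eq by simp
  then show False
    using \<delta>(2,3) assms(1,2) by (simp add: hom_mult[OF \<delta>(1)])
qed

lemma commute_iff:
  assumes "v \<in> V" "w \<in> V"
  shows "s v \<otimes> s w = s w \<otimes> s v \<longleftrightarrow> v = w \<or> {v, w} \<in> E"
  using assms nonadjacent_not_commute s_comm by metis

lemma s_not_one: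
  assumes "v \<in> V" shows "s v \<noteq> \<one>"
proof
  assume eq: "s v = \<one>"
  define f where "f u = (if u = v then Not else id)" for u
  obtain h where h: "h \<in> hom W (perms :: (bool \<Rightarrow> bool) monoid)" "\<And>u. u \<in> V \<Longrightarrow> h (s u) = f u"
  proof (rule universal[of "perms :: (bool \<Rightarrow> bool) monoid" f])
    show "f u \<in> carrier perms" for u by (auto simp: f_def intro!: bij_involution)
  qed (auto simp: group_perms f_def that fun_eq_iff)
  have "h \<one> = id"
    using hom_one[OF h(1) group_axioms group_perms] by simp
  then show False using h(2)[OF assms] eq by (auto simp: f_def fun_eq_iff)
qed

text \<open>A quotient of \<open>W\<close> in which conjugates of \<open>s v\<close> are easily told apart: they become
involutions \<open>flip q\<close> at the positions \<open>q\<close> in the orbit of \<open>p\<close> under \<open>\<alpha>\<close> and \<open>\<beta>\<close>.\<close>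
lemma wreath_hom:
  fixes \<alpha> \<beta> :: "'p \<Rightarrow> 'p"
  assumes V: "v \<in> V" "u \<in> V" "w \<in> V" and ne: "u \<noteq> v" "w \<noteq> v" "u \<noteq> w"
    and inv: "\<alpha> \<circ> \<alpha> = id" "\<beta> \<circ> \<beta> = id"
    and E: "{u, w} \<in> E \<Longrightarrow> \<alpha> \<circ> \<beta> = \<beta> \<circ> \<alpha>" "{v, u} \<in> E \<Longrightarrow> \<alpha> p = p" "{v, w} \<in> E \<Longrightarrow> \<beta> p = p"
  obtains \<Phi> where "\<Phi> \<in> hom W perms" "\<Phi> (s v) = flip p"
    "\<Phi> (s u) = map_prod \<alpha> id" "\<Phi> (s w) = map_prod \<beta> id"
proof -
  define f where "f x = (if x = v then flip p else if x = u then map_prod \<alpha> id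
    else if x = w then map_prod \<beta> id else id)" for x
  have inj: "inj \<alpha>" "inj \<beta>" using inv bij_involution bij_is_inj by auto
  have comm: "f x \<circ> f y = f y \<circ> f x" if "{x, y} \<in> E" "x \<noteq> y" for x y
    using that ne E map_prod_flip[OF inj(1), of p] map_prod_flip[OF inj(2), of p]
    by (auto simp: f_def insert_commute simp flip: map_prod_compose)
  have sq: "f x \<circ> f x = id" for x
    using inv by (simp add: f_def map_prod_involution)
  obtain \<Phi> where "\<Phi> \<in> hom W perms" "\<And>x. x \<in> V \<Longrightarrow> \<Phi> (s x) = f x"
  proof (rule universal[OF group_perms, of f])
    show "f x \<in> carrier perms" for x using bij_involution[OF sq] by simp
    show "f x \<otimes>\<^bsub>perms\<^esub> f x = \<one>\<^bsub>perms\<^esub>" for x using sq by simp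
    show "f x \<otimes>\<^bsub>perms\<^esub> f y = f y \<otimes>\<^bsub>perms\<^esub> f x" if "{x, y} \<in> E" "x \<noteq> y" for x y
      using comm[OF that] by simp
  qed (rule that)
  then show thesis using that[of \<Phi>] V ne by (auto simp: f_def)
qed

lemma wreath_conjugates:
  fixes p :: 'p
  assumes v: "v \<in> V" and \<Phi>: "\<Phi> \<in> hom W perms" "\<Phi> (s v) = flip p"
    and ls: "set ls \<subseteq> L (V - {v})" "\<And>l. l \<in> set ls \<Longrightarrow> \<Phi> l = map_prod (\<sigma> l) id"
    and dist: "distinct (map (\<lambda>l. \<sigma> l p) ls)"
  shows "\<exists>D \<subseteq> conjugates v. card D = length ls"
proof -
  have "\<Phi> (conj_by l (s v)) = flip (\<sigma> l p)" if l: "l \<in> set ls" for l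
  proof -
    have lc: "l \<in> carrier W" using l ls(1) L_carrier[of "V - {v}"] by auto
    have bij: "bij (\<Phi> l)" using hom_in_carrier[OF \<Phi>(1) lc] by simp
    then have "inj (\<sigma> l)"
      using ls(2)[OF l] by (metis (no_types, lifting) bij_is_inj injD injI map_prod_simp prod.inject)
    then have "\<Phi> (conj_by l (s v)) \<circ> \<Phi> l = flip (\<sigma> l p) \<circ> \<Phi> l"
      using conj_commute[OF lc, of "s v"] v lc \<Phi>(2) ls(2)[OF l] map_prod_flip[of "\<sigma> l" p]
        hom_mult[OF \<Phi>(1), of "conj_by l (s v)" l] hom_mult[OF \<Phi>(1), of l "s v"]
      by simp
    then show ?thesis
      using bij_is_surj[OF bij] by (metis surj_fun_eq comp_apply ext surjE)
  qed
  then have "inj_on (\<lambda>l. conj_by l (s v)) (set ls)"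
    using dist by (intro inj_onI) (metis distinct_map flip_inject inj_onD)
  then have "card ((\<lambda>l. conj_by l (s v)) ` set ls) = length ls"
    using dist by (simp add: card_image distinct_card distinct_map)
  moreover have "(\<lambda>l. conj_by l (s v)) ` set ls \<subseteq> conjugates v"
    unfolding conjugates_def using ls(1) by (rule image_mono)
  ultimately show ?thesis by blast
qed

lemma four_conjugates_fork:
  assumes V: "v \<in> V" "u \<in> V" "w \<in> V" and ne: "u \<noteq> v" "w \<noteq> v" "u \<noteq> w"
    and E: "{v, u} \<notin> E" "{v, w} \<notin> E"
  shows "\<exists>D \<subseteq> conjugates v. card D = 4"
proof -
  \<comment> \<open>the two vertices act on four positions by commuting involutions, which is compatible with
    both presence and absence of an edge between them\<close>
  let ?\<alpha> = "\<lambda>(a, b). (\<not> a, b :: bool)" and ?\<beta> = "\<lambda>(a :: bool, b). (a, \<not> b)"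
  obtain \<Phi> where \<Phi>: "\<Phi> \<in> hom W perms" "\<Phi> (s v) = flip (False, False)"
    "\<Phi> (s u) = map_prod ?\<alpha> id" "\<Phi> (s w) = map_prod ?\<beta> id"
    by (rule wreath_hom[OF V ne, of ?\<alpha> ?\<beta> "(False, False)"]) (use E in \<open>auto simp: fun_eq_iff that\<close>)
  have uw: "s u \<in> L (V - {v})" "s w \<in> L (V - {v})"
    using V ne by (auto intro!: generate.incl)
  let ?ls = "[\<one>, s u, s w, s u \<otimes> s w]"
  have *: "\<Phi> \<one> = map_prod id id" "\<Phi> (s u \<otimes> s w) = map_prod (?\<alpha> \<circ> ?\<beta>) id"
    using hom_one[OF \<Phi>(1) group_axioms group_perms] hom_mult[OF \<Phi>(1)] V \<Phi>(3,4)
    by (simp_all add: prod.map_id0 map_prod_compose[symmetric])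
  define \<sigma> where "\<sigma> l q = fst (\<Phi> l (q, False))" for l q
  have "\<exists>D \<subseteq> conjugates v. card D = length ?ls"
  proof (rule wreath_conjugates[OF V(1) \<Phi>(1,2), where \<sigma> = \<sigma>])
    show "set ?ls \<subseteq> L (V - {v})" using uw by (auto intro: generate.one generate.eng)
    show "\<Phi> l = map_prod (\<sigma> l) id" if "l \<in> set ?ls" for l
      using that * \<Phi>(3,4) by (auto simp: \<sigma>_def fun_eq_iff)
    show "distinct (map (\<lambda>l. \<sigma> l (False, False)) ?ls)"
      using * \<Phi>(3,4) by (simp add: \<sigma>_def)
  qed
  then show ?thesis by (simp add: eval_nat_numeral)
qed

lemma four_conjugates_path:
  assumes V: "v \<in> V" "u \<in> V" "w \<in> V" and ne: "u \<noteq> v" "w \<noteq> v" "u \<noteq> w"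
    and E: "{v, w} \<notin> E" "{u, w} \<notin> E"
  shows "\<exists>D \<subseteq> conjugates v. card D = 4"
proof -
  \<comment> \<open>the orbit of the position 0, which is fixed by the first reflection, starts with 0, 1, - 1, 2\<close>
  let ?\<alpha> = "\<lambda>n :: int. - n" and ?\<beta> = "\<lambda>n :: int. 1 - n"
  obtain \<Phi> where \<Phi>: "\<Phi> \<in> hom W perms" "\<Phi> (s v) = flip 0"
    "\<Phi> (s u) = map_prod ?\<alpha> id" "\<Phi> (s w) = map_prod ?\<beta> id"
    by (rule wreath_hom[OF V ne, of ?\<alpha> ?\<beta> 0]) (use E in \<open>auto simp: fun_eq_iff that\<close>)
  have uw: "s u \<in> L (V - {v})" "s w \<in> L (V - {v})"
    using V ne by (auto intro!: generate.incl)
  let ?ls = "[\<one>, s w, s u \<otimes> s w, s w \<otimes> (s u \<otimes> s w)]"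
  have *: "\<Phi> \<one> = map_prod id id" "\<Phi> (s u \<otimes> s w) = map_prod (?\<alpha> \<circ> ?\<beta>) id"
    "\<Phi> (s w \<otimes> (s u \<otimes> s w)) = map_prod (?\<beta> \<circ> (?\<alpha> \<circ> ?\<beta>)) id"
    using hom_one[OF \<Phi>(1) group_axioms group_perms] hom_mult[OF \<Phi>(1)] V \<Phi>(3,4)
    by (simp_all add: prod.map_id0 map_prod_compose[symmetric])
  define \<sigma> where "\<sigma> l q = fst (\<Phi> l (q, False))" for l q
  have "\<exists>D \<subseteq> conjugates v. card D = length ?ls"
  proof (rule wreath_conjugates[OF V(1) \<Phi>(1,2), where \<sigma> = \<sigma>])
    show "set ?ls \<subseteq> L (V - {v})" using uw by (auto intro: generate.one generate.eng)
    show "\<Phi> l = map_prod (\<sigma> l) id" if "l \<in> set ?ls" for l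
      using that * \<Phi>(3,4) by (auto simp: \<sigma>_def fun_eq_iff)
    show "distinct (map (\<lambda>l. \<sigma> l 0) ?ls)"
      using * \<Phi>(3,4) by (simp add: \<sigma>_def)
  qed
  then show ?thesis by (simp add: eval_nat_numeral)
qed

lemma commute_with_generators:
  assumes g: "g \<in> carrier W" and comm: "\<And>v. v \<in> V \<Longrightarrow> g \<otimes> s v = s v \<otimes> g"
    and x: "x \<in> carrier W"
  shows "g \<otimes> x = x \<otimes> g"
proof -
  have "conj_by g x = id x"
  proof (rule hom_eq_on_generate[of W W "conj_by g" id "s ` V"])
    show "conj_by g \<in> hom W W" using g by (auto simp: hom_def conj_distrib)
    show "id \<in> hom W W" by (simp add: hom_def)
    show "conj_by g y = id y" if y: "y \<in> s ` V" for y
    proof -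
      obtain u where "u \<in> V" "y = s u" using y by blast
      then show ?thesis using g comm[of u] by (simp add: conj_eq_iff)
    qed
  qed (use x in \<open>simp_all add: group_axioms generate_V s_image\<close>)
  then show ?thesis using g x by (simp add: conj_eq_iff)
qed

definition center :: "'a word set set set" where
  "center = {z \<in> carrier W. \<forall>g\<in>carrier W. z \<otimes> g = g \<otimes> z}"

text \<open>Write a central element as \<open>z = k l\<close> with \<open>k\<close> in the free product of the conjugates of \<open>s v\<close>
and \<open>l\<close> in the complement. Were \<open>k\<close> nontrivial, then a conjugate \<open>c\<close> different from its last
letter would have a reduced conjugate \<open>k c k\<^sup>-\<^sup>1\<close> of length at least three; but \<open>z\<close> commutes with
\<open>b = l\<^sup>-\<^sup>1 c l\<close>, so \<open>k c k\<^sup>-\<^sup>1\<close> is the single letter \<open>b\<close>.\<close>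
lemma center_avoids_nonadjacent:
  assumes z: "z \<in> center" and v: "v \<in> V" and w: "w \<in> V" "w \<noteq> v" "{v, w} \<notin> E"
  shows "z \<in> L (V - {v})"
proof -
  note Cc = conjugates_closed[OF v]
  have zc: "z \<in> carrier W" and comm: "\<And>g. g \<in> carrier W \<Longrightarrow> z \<otimes> g = g \<otimes> z"
    using z by (auto simp: center_def)
  obtain cs l where n: "distinct_adj cs" "set cs \<subseteq> conjugates v" "l \<in> L (V - {v})"
    "z = listprod cs \<otimes> l"
    using normal_form[OF v zc] by blast
  have lc: "l \<in> carrier W" using L_carrier[of "V - {v}"] n(3) by auto
  have sw: "s w \<in> L (V - {v})" using w by (auto intro: generate.incl)
  have cs: "set cs \<subseteq> carrier W" using n(2) Cc by blast
  have "cs = []"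
  proof (rule ccontr)
    assume ne: "cs \<noteq> []"
    have "conj_by (s w) (s v) \<noteq> s v"
      using v w commute_iff[of w v] by (auto simp: conj_eq_iff insert_commute)
    then obtain c where c: "c \<in> conjugates v" "c \<noteq> last cs"
      using conjugates_conj[OF v sw self_conjugate[OF v]] self_conjugate[OF v] by metis
    define b where "b = conj_by (inv l) c"
    have "inv l \<in> L (V - {v})"
      using subgroup.m_inv_closed[OF L_subgroup n(3)] by auto
    then have b: "b \<in> conjugates v" unfolding b_def using c(1) by (intro conjugates_conj v)
    have cc: "c \<in> carrier W" "b \<in> carrier W" "c \<otimes> c = \<one>"
      using c(1) b Cc conjugates_square[OF v] by auto
    have lb: "l \<otimes> b = c \<otimes> l"
      using lc cc(1) by (simp add: b_def conj_by_def m_assoc[symmetric])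
    have "listprod cs \<otimes> c \<otimes> l = z \<otimes> b"
      using n(4) cs lc cc lb by (simp add: m_assoc)
    also have "\<dots> = b \<otimes> listprod cs \<otimes> l"
      using comm[OF cc(2)] n(4) cs lc cc by (simp add: m_assoc)
    finally have "listprod cs \<otimes> c = b \<otimes> listprod cs"
      using cs lc cc by simp
    moreover have "listprod (cs @ [c] @ rev cs) = listprod cs \<otimes> c \<otimes> inv (listprod cs)"
      using cs cc listprod_rev[OF cs] conjugates_square[OF v] n(2)
      by (simp add: listprod_append subset_iff m_assoc)
    ultimately have "listprod (cs @ [c] @ rev cs) = b"
      using cs cc by (simp add: m_assoc)
    then have "listprod (cs @ [c] @ rev cs) = listprod [b]" using cc by simp
    moreover have "distinct_adj (cs @ [c] @ rev cs)"
      using n(1) c(2) ne by (auto simp: distinct_adj_append_iff distinct_adj_Cons hd_rev)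
    ultimately have "cs @ [c] @ rev cs = [b]"
      using n(2) c(1) b by (intro reduced_unique[OF v]) auto
    then have "length (cs @ [c] @ rev cs) = length [b]" by (rule arg_cong)
    then show False using ne by simp
  qed
  then show ?thesis using n(3,4) lc by simp
qed

text \<open>The centre is generated by the vertices adjacent to all others: applying, one after the
other, the retractions that kill the remaining vertices does not move a central element.\<close>
lemma center_finite: "finite center"
proof -
  define U where "U = {v \<in> V. \<exists>w\<in>V. w \<noteq> v \<and> {v, w} \<notin> E}"
  have sub: "z \<in> L (V - A)" if z: "z \<in> center" and "finite A" "A \<subseteq> U" for z A
    using that(2,3)
  proof (induction A)
    case empty
    then show ?case using z by (simp add: generate_V center_def)
  next
    case (insert v A)
    obtain \<rho> where \<rho>: "\<And>x. x \<in> L (V - {v}) \<Longrightarrow> \<rho> x = x"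
      "\<And>B x. B \<subseteq> V \<Longrightarrow> x \<in> L B \<Longrightarrow> \<rho> x \<in> L (B - {v})"
      by (rule retraction[of "{v}"]) (rule that)
    have "z \<in> L (V - {v})"
      using insert.prems center_avoids_nonadjacent[OF z] by (auto simp: U_def)
    then have "\<rho> z = z" by (rule \<rho>(1))
    moreover have "\<rho> z \<in> L (V - A - {v})"
      using insert.prems by (intro \<rho>(2) insert.IH) simp_all
    ultimately show ?case unfolding Diff_insert[of V v A] by (simp only:)
  qed
  have "finite (L (V - U))"
  proof (rule finite_generate_central_involutions)
    show "t \<otimes> x = x \<otimes> t" if t: "t \<in> s ` (V - U)" and x: "x \<in> carrier W" for t x
    proof -
      obtain v where v: "v \<in> V" "v \<notin> U" "t = s v" using t by blast
      have *: "s v \<otimes> s w = s w \<otimes> s v" if "w \<in> V" for w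
        using v that commute_iff[of v w] by (auto simp: U_def)
      show ?thesis
        using v * x by (simp add: commute_with_generators)
    qed
  qed (use finite_V in auto)
  moreover have "center \<subseteq> L (V - U)"
    using sub[of _ U] finite_V by (auto simp: U_def)
  ultimately show ?thesis by (rule rev_finite_subset)
qed

end


section \<open>Normal subgroups of the automorphism group\<close>

context group
begin

definition inner :: "'a \<Rightarrow> 'a \<Rightarrow> 'a" where
  "inner g = restrict (conj_by g) (carrier G)"

lemma carrier_AutoGroup [simp]: "carrier (AutoGroup G) = auto G"
  by (simp add: AutoGroup_def)

lemma mult_AutoGroup:
  "f \<in> auto G \<Longrightarrow> g \<in> auto G \<Longrightarrow> f \<otimes>\<^bsub>AutoGroup G\<^esub> g = compose (carrier G) f g"
  by (simp add: AutoGroup_def BijGroup_def auto_def)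

lemma one_AutoGroup: "\<one>\<^bsub>AutoGroup G\<^esub> = (\<lambda>x\<in>carrier G. x)"
  by (simp add: AutoGroup_def BijGroup_def)

lemma auto_hom: "f \<in> auto G \<Longrightarrow> f \<in> hom G G"
  by (simp add: auto_def)

lemma auto_eqI:
  assumes "f \<in> auto G" "g \<in> auto G" "\<And>x. x \<in> carrier G \<Longrightarrow> f x = g x"
  shows "f = g"
  using assms by (intro extensionalityI[of _ "carrier G"]) (auto simp: auto_def Bij_def)

lemma inner_auto:
  assumes g: "g \<in> carrier G"
  shows "inner g \<in> auto G"
proof -
  have "inj_on (conj_by g) (carrier G)"
    using bij_conj[OF g] by (auto simp: bij_def inj_on_def)
  moreover have "conj_by g ` carrier G = carrier G"
  proof (intro equalityI subsetI)
    fix y assume "y \<in> carrier G"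
    moreover obtain x where "y = conj_by g x"
      using bij_is_surj[OF bij_conj[OF g]] by (rule surjE)
    ultimately show "y \<in> conj_by g ` carrier G"
      using g by simp
  qed (use g in auto)
  ultimately show ?thesis
    using g by (auto simp: auto_def Bij_def inner_def hom_def conj_distrib bij_betw_def inj_on_def)
qed

lemma inner_hom: "inner \<in> hom G (AutoGroup G)"
proof (rule homI)
  show "inner (g \<otimes> h) = inner g \<otimes>\<^bsub>AutoGroup G\<^esub> inner h"
    if gh: "g \<in> carrier G" "h \<in> carrier G" for g h
    using gh unfolding mult_AutoGroup[OF inner_auto[OF gh(1)] inner_auto[OF gh(2)]]
    by (auto simp: inner_def compose_def conj_mult fun_eq_iff)
qed (simp add: inner_auto)

lemma inner_eq_one_iff:
  assumes "g \<in> carrier G"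
  shows "inner g = \<one>\<^bsub>AutoGroup G\<^esub> \<longleftrightarrow> (\<forall>x\<in>carrier G. g \<otimes> x = x \<otimes> g)"
  using assms by (auto simp: one_AutoGroup inner_def restrict_def fun_eq_iff conj_eq_iff)

lemma auto_inner:
  assumes f: "f \<in> auto G" and g: "g \<in> carrier G"
  shows "f \<otimes>\<^bsub>AutoGroup G\<^esub> inner g \<otimes>\<^bsub>AutoGroup G\<^esub> inv\<^bsub>AutoGroup G\<^esub> f = inner (f g)"
proof -
  interpret A: group "AutoGroup G" by (rule AutoGroup)
  interpret f: group_hom G G f
    using auto_hom[OF f] by unfold_locales
  have c: "f \<in> carrier (AutoGroup G)" "inner g \<in> carrier (AutoGroup G)" "inner (f g) \<in> carrier (AutoGroup G)"
    using f g by (simp_all add: inner_auto)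
  have "compose (carrier G) f (inner g) x = compose (carrier G) (inner (f g)) f x" for x
    using g by (simp add: compose_def inner_def conj_by_def)
  then have "f \<otimes>\<^bsub>AutoGroup G\<^esub> inner g = inner (f g) \<otimes>\<^bsub>AutoGroup G\<^esub> f"
    using c by (simp add: mult_AutoGroup fun_eq_iff)
  then show ?thesis
    using c by (simp add: A.inv_solve_right' del: carrier_AutoGroup)
qed

lemma inner_in_normal:
  assumes N: "N \<lhd> AutoGroup G"
  shows "{g \<in> carrier G. inner g \<in> N} \<lhd> G"
proof -
  interpret N: normal N "AutoGroup G" by fact
  interpret i: group_hom G "AutoGroup G" inner
    using inner_hom by unfold_locales
  show ?thesis
  proof (rule normal_invI)
    show "subgroup {g \<in> carrier G. inner g \<in> N} G"
      by (rule subgroupI) (auto intro!: exI[of _ \<one>])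
    show "g \<otimes> h \<otimes> inv g \<in> {g \<in> carrier G. inner g \<in> N}"
      if "g \<in> carrier G" "h \<in> {g \<in> carrier G. inner g \<in> N}" for g h
      using that N.inv_op_closed2[of "inner g" "inner h"] by (auto simp: inner_auto)
  qed
qed

lemma auto_commutator:
  assumes N: "N \<lhd> AutoGroup G" and f: "f \<in> N" and g: "g \<in> carrier G"
  shows "f g \<otimes> inv g \<in> carrier G" "inner (f g \<otimes> inv g) \<in> N"
proof -
  interpret N: normal N "AutoGroup G" by fact
  interpret i: group_hom G "AutoGroup G" inner
    using inner_hom by unfold_locales
  let ?A = "AutoGroup G"
  have fA: "f \<in> carrier ?A" using f N.subset by auto
  then have fg: "f g \<in> carrier G"
    using g hom_in_carrier[OF auto_hom[of f]] by simp
  then show "f g \<otimes> inv g \<in> carrier G" using g by simp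
  have ig: "inner g \<in> carrier ?A" using g by (simp add: inner_auto)
  have "inner (f g \<otimes> inv g) = f \<otimes>\<^bsub>?A\<^esub> inner g \<otimes>\<^bsub>?A\<^esub> inv\<^bsub>?A\<^esub> f \<otimes>\<^bsub>?A\<^esub> inv\<^bsub>?A\<^esub> inner g"
    using fA fg g auto_inner[of f g] by simp
  also have "\<dots> = f \<otimes>\<^bsub>?A\<^esub> (inner g \<otimes>\<^bsub>?A\<^esub> inv\<^bsub>?A\<^esub> f \<otimes>\<^bsub>?A\<^esub> inv\<^bsub>?A\<^esub> inner g)"
    using fA ig by (simp add: N.m_assoc del: carrier_AutoGroup)
  also have "\<dots> \<in> N"
    using subgroup.m_closed[OF N.subgroup_axioms f]
      N.inv_op_closed2[OF ig subgroup.m_inv_closed[OF N.subgroup_axioms f]] by blast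
  finally show "inner (f g \<otimes> inv g) \<in> N" .
qed

end

context right_angled
begin

text \<open>An automorphism is determined by the images of the finitely many generators, each of which
lies in a single coset of the finite centre.\<close>
lemma finite_automorphisms:
  assumes N: "N \<subseteq> auto W" and Z: "\<And>f g. f \<in> N \<Longrightarrow> g \<in> carrier W \<Longrightarrow> f g \<otimes> inv g \<in> center"
  shows "finite N"
proof (rule inj_on_finite)
  let ?r = "\<lambda>f. restrict f (s ` V)"
  show "inj_on ?r N"
  proof (rule inj_onI)
    fix f g assume fg: "f \<in> N" "g \<in> N" "?r f = ?r g"
    then have hom: "f \<in> hom W W" "g \<in> hom W W" using N auto_hom by auto
    have eq: "f y = g y" if "y \<in> s ` V" for y
      using fun_cong[OF fg(3), of y] that by simp
    have "f x = g x" if "x \<in> carrier W" for x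
      using hom_eq_on_generate[OF group_axioms group_axioms hom s_image[OF subset_refl] eq] that
      by (simp only: generate_V)
    then show "f = g" using fg N by (intro auto_eqI) auto
  qed
  show "?r ` N \<subseteq> PiE (s ` V) (\<lambda>y. (\<lambda>z. z \<otimes> y) ` center)"
  proof (intro image_subsetI PiE_I)
    fix f y assume f: "f \<in> N" and "y \<in> s ` V"
    then have y: "y \<in> s ` V" "y \<in> carrier W" using s_image by auto
    have fy: "f y \<in> carrier W"
      using f N y(2) hom_in_carrier[OF auto_hom] by blast
    have "f y = (f y \<otimes> inv y) \<otimes> y"
      using fy y(2) by (simp add: m_assoc)
    then show "?r f y \<in> (\<lambda>z. z \<otimes> y) ` center"
      using y Z[OF f y(2)] by simp
  qed simp
  show "finite (PiE (s ` V) (\<lambda>y. (\<lambda>z. z \<otimes> y) ` center))"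
    using finite_V center_finite by (intro finite_PiE) auto
qed

text \<open>In \<open>m (s v) m\<^sup>-\<^sup>1 (s v)\<close> the component of \<open>m\<close> outside the normal closure of \<open>s v\<close> only
matters through the conjugate \<open>l (s v) l\<^sup>-\<^sup>1\<close>, so the commutator is a product of conjugates of \<open>s
v\<close>.\<close>
lemma commutator_reduced:
  assumes v: "v \<in> V" and m: "m \<in> carrier W" and nc: "m \<otimes> s v \<noteq> s v \<otimes> m"
    and M: "M \<lhd> W" "m \<in> M"
  obtains cs where "distinct_adj cs" "set cs \<subseteq> conjugates v" "cs \<noteq> []" "listprod cs \<in> M"
proof -
  interpret M: normal M W by fact
  note Cc = conjugates_closed[OF v]
  obtain cs l where n: "distinct_adj cs" "set cs \<subseteq> conjugates v" "l \<in> L (V - {v})"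
    "m = listprod cs \<otimes> l"
    using normal_form[OF v m] by blast
  have lc: "l \<in> carrier W" using L_carrier[of "V - {v}"] n(3) by auto
  have cs: "set cs \<subseteq> carrier W" using n(2) Cc by blast
  let ?ds = "cs @ [conj_by l (s v)] @ rev cs @ [s v]"
  have ds: "set ?ds \<subseteq> conjugates v"
    using n(2) conjugates_conj[OF v n(3) self_conjugate[OF v]] self_conjugate[OF v] by auto
  have sv: "s v \<in> carrier W" using v by simp
  have lr: "listprod (rev cs) = inv (listprod cs)"
    using n(2) conjugates_square[OF v] by (intro listprod_rev[OF cs]) auto
  have "listprod ?ds = listprod cs \<otimes> conj_by l (s v) \<otimes> inv (listprod cs) \<otimes> s v"
    using cs lc sv by (simp add: listprod_append lr m_assoc)
  also have "\<dots> = m \<otimes> s v \<otimes> inv m \<otimes> s v"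
    using cs lc sv n(4) by (simp add: conj_by_def inv_mult_group m_assoc)
  finally have dsv: "listprod ?ds = m \<otimes> s v \<otimes> inv m \<otimes> s v" .
  also have "\<dots> = m \<otimes> (s v \<otimes> inv m \<otimes> inv (s v))"
    using m sv v by (simp add: m_assoc)
  also have "\<dots> \<in> M"
    using M(2) sv by (intro M.m_closed M.inv_op_closed2 M.m_inv_closed)
  finally have in_M: "listprod ?ds \<in> M" .
  have "listprod ?ds \<noteq> \<one>"
  proof
    assume "listprod ?ds = \<one>"
    then have "m \<otimes> s v \<otimes> inv m = s v"
      using dsv m sv v inv_equality[of "m \<otimes> s v \<otimes> inv m" "s v"] by (metis inv_closed m_closed s_inv)
    then show False using nc m sv by (simp add: inv_solve_right')
  qed
  moreover obtain es where "distinct_adj es" "set es \<subseteq> conjugates v" "listprod es = listprod ?ds"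
    using listprod_reduce[OF ds Cc] conjugates_square[OF v] by blast
  ultimately show thesis using that[of es] in_M by fastforce
qed

theorem normal_subgroup_dichotomy:
  assumes four: "\<And>v w. v \<in> V \<Longrightarrow> w \<in> V \<Longrightarrow> w \<noteq> v \<Longrightarrow> {v, w} \<notin> E \<Longrightarrow> \<exists>D \<subseteq> conjugates v. card D = 4"
    and N: "N \<lhd> AutoGroup W"
  shows "finite N \<or> full_sized ((AutoGroup W)\<lparr>carrier := N\<rparr>)"
proof -
  let ?A = "AutoGroup W"
  interpret N: normal N ?A by fact
  interpret i: group_hom W ?A inner
    using inner_hom by unfold_locales
  define M where "M = {g \<in> carrier W. inner g \<in> N}"
  have M: "M \<lhd> W" unfolding M_def using N by (rule inner_in_normal)
  show ?thesis
  proof (cases "M \<subseteq> center")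
    case True
    have "finite N"
      using N.subset auto_commutator[OF N] True by (intro finite_automorphisms) (auto simp: M_def)
    then show ?thesis ..
  next
    case False
    then obtain m where m: "m \<in> M" "m \<notin> center" by blast
    then have mc: "m \<in> carrier W" by (simp add: M_def)
    have "\<exists>v\<in>V. m \<otimes> s v \<noteq> s v \<otimes> m"
      using m(2) mc commute_with_generators[OF mc] unfolding center_def by blast
    then obtain v where v: "v \<in> V" "m \<otimes> s v \<noteq> s v \<otimes> m" by blast
    have "\<exists>w\<in>V. w \<noteq> v \<and> {v, w} \<notin> E"
    proof (rule ccontr)
      assume "\<not> ?thesis"
      then have "v = w \<or> {v, w} \<in> E" if "w \<in> V" for w using that by auto
      then have "s v \<otimes> s w = s w \<otimes> s v" if "w \<in> V" for w
        using that v(1) by (simp add: commute_iff)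
      then show False
        using commute_with_generators[of "s v" m] v mc by simp
    qed
    then obtain D where D: "D \<subseteq> conjugates v" "card D = 4"
      using four v(1) by blast
    obtain cs where cs: "distinct_adj cs" "set cs \<subseteq> conjugates v" "cs \<noteq> []" "listprod cs \<in> M"
      using commutator_reduced[OF v(1) mc v(2) M m(1)] by blast
    obtain f :: "bool \<Rightarrow> 'a word set set" where f: "\<And>i. f i \<in> M"
      "\<And>w. freely_reduced w \<Longrightarrow> w \<noteq> [] \<Longrightarrow>
        \<exists>ds. ds \<noteq> [] \<and> distinct_adj ds \<and> set ds \<subseteq> conjugates v \<and> eval_word W f w = listprod ds"
      using free_pair[OF v(1) D M cs] by blast
    interpret N': group "?A\<lparr>carrier := N\<rparr>"
      by (rule N.subgroup_is_group[OF N.group_axioms])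
    have "full_sized (?A\<lparr>carrier := N\<rparr>)"
    proof (rule N'.full_sizedI)
      show "inner (f j) \<in> carrier (?A\<lparr>carrier := N\<rparr>)" for j
        using f(1) by (auto simp: M_def)
      show "eval_word (?A\<lparr>carrier := N\<rparr>) (\<lambda>j. inner (f j)) w \<noteq> \<one>\<^bsub>?A\<lparr>carrier := N\<rparr>\<^esub>"
        if w: "freely_reduced w" "w \<noteq> []" for w
      proof -
        obtain ds where ds: "ds \<noteq> []" "distinct_adj ds" "set ds \<subseteq> conjugates v"
          "eval_word W f w = listprod ds"
          using f(2)[OF w] by blast
        have dc: "listprod ds \<in> carrier W"
          using ds(3) conjugates_closed[OF v(1)] by (intro listprod_closed) blast
        have "eval_word (?A\<lparr>carrier := N\<rparr>) (\<lambda>j. inner (f j)) w = eval_word ?A (\<lambda>j. inner (f j)) w"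
          using f(1) by (intro N.eval_word_consistent) (auto simp: M_def N.subgroup_axioms)
        also have "\<dots> = inner (eval_word W f w)"
          using f(1) eval_word_hom[OF N.group_axioms inner_hom, of f UNIV w]
          by (auto simp: M_def words_def)
        finally show ?thesis
          using reduced_not_central[OF v(1) D(1) _ ds(2,3,1)] D(2) dc inner_eq_one_iff[OF dc] ds(4)
          by auto
      qed
    qed
    then show ?thesis ..
  qed
qed

end


section \<open>The infinite dihedral group as a free product\<close>

text \<open>The elements \<open>a\<close> and \<open>b\<close> generate an infinite dihedral subgroup, which may be smaller than
\<open>G\<close>.\<close>
definition infinite_dihedral :: "('a, 'b) monoid_scheme \<Rightarrow> 'a \<Rightarrow> 'a \<Rightarrow> bool" where
  "infinite_dihedral G a b \<longleftrightarrow> a \<in> carrier G \<and> b \<in> carrier G \<and>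
     a \<otimes>\<^bsub>G\<^esub> a = \<one>\<^bsub>G\<^esub> \<and> b \<otimes>\<^bsub>G\<^esub> b = \<one>\<^bsub>G\<^esub> \<and>
     (\<forall>n :: nat. n > 0 \<longrightarrow> (a \<otimes>\<^bsub>G\<^esub> b) [^]\<^bsub>G\<^esub> n \<noteq> \<one>\<^bsub>G\<^esub>)"

lemma (in group) two_involutions_normal_form:
  assumes ab: "a \<in> carrier G" "b \<in> carrier G" "a \<otimes> a = \<one>" "b \<otimes> b = \<one>"
    and x: "x \<in> generate G {a, b}"
  shows "\<exists>k :: int. x = (a \<otimes> b) [^] k \<or> x = (a \<otimes> b) [^] k \<otimes> a"
proof -
  let ?t = "a \<otimes> b"
  have inv: "inv a = a" "inv b = b" using ab by (simp_all add: inv_equality)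
  have t: "?t \<in> carrier G" using ab by simp
  interpret c: group_hom G G "conj_by a"
    using ab by unfold_locales (auto simp: hom_def conj_distrib)
  have "conj_by a ?t = inv ?t"
    using ab inv by (simp add: conj_by_def inv_mult_group m_assoc[symmetric])
  then have flip: "a \<otimes> ?t [^] k = ?t [^] (- k) \<otimes> a" for k :: int
    using conj_commute[of a "?t [^] k"] ab t
    by (simp add: c.hom_int_pow int_pow_inv int_pow_neg)
  have b: "b = ?t [^] (- 1 :: int) \<otimes> a"
    using flip[of 1] ab by (simp add: m_assoc[symmetric])
  show ?thesis
    using x
  proof induction
    case one
    show ?case by (rule exI[of _ 0]) simp
  next
    case (incl h)
    then consider "h = a" | "h = b" by blast
    then show ?case
    proof cases
      case 1
      then show ?thesis using ab by (intro exI[of _ 0]) simp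
    next
      case 2
      then show ?thesis using b by (intro exI[of _ "- 1"]) simp
    qed
  next
    case (inv h)
    then consider "h = a" | "h = b" by blast
    then show ?case
    proof cases
      case 1
      then show ?thesis using ab \<open>inv a = a\<close> by (intro exI[of _ 0]) simp
    next
      case 2
      then show ?thesis using b \<open>inv b = b\<close> by (intro exI[of _ "- 1"]) simp
    qed
  next
    case (eng x y)
    then obtain k l :: int where k: "x = ?t [^] k \<or> x = ?t [^] k \<otimes> a"
      and l: "y = ?t [^] l \<or> y = ?t [^] l \<otimes> a" by blast
    have 1: "?t [^] k \<otimes> ?t [^] l = ?t [^] (k + l)"
      using t by (simp add: int_pow_mult)
    have 2: "?t [^] k \<otimes> (?t [^] l \<otimes> a) = ?t [^] (k + l) \<otimes> a"
      using t ab(1) by (simp add: int_pow_mult m_assoc)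
    have 3: "?t [^] k \<otimes> a \<otimes> ?t [^] l = ?t [^] (k - l) \<otimes> a"
    proof -
      have "?t [^] k \<otimes> a \<otimes> ?t [^] l = ?t [^] k \<otimes> (a \<otimes> ?t [^] l)"
        using t ab(1) by (simp only: m_assoc int_pow_closed)
      also have "\<dots> = ?t [^] k \<otimes> ?t [^] (- l) \<otimes> a"
        unfolding flip using t ab(1) by (simp only: m_assoc int_pow_closed)
      finally show ?thesis using t by (simp flip: int_pow_mult)
    qed
    have 4: "?t [^] k \<otimes> a \<otimes> (?t [^] l \<otimes> a) = ?t [^] (k - l)"
    proof -
      have "?t [^] k \<otimes> a \<otimes> (?t [^] l \<otimes> a) = ?t [^] k \<otimes> a \<otimes> ?t [^] l \<otimes> a"
        using t ab(1) by (simp only: m_assoc int_pow_closed m_closed)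
      also have "\<dots> = ?t [^] (k - l) \<otimes> (a \<otimes> a)"
        unfolding 3 using t ab(1) by (simp only: m_assoc int_pow_closed)
      finally show ?thesis using t ab(3) by simp
    qed
    show ?case using k l 1 2 3 4 by metis
  qed
qed

text \<open>A kernel element \<open>(a b)\<^sup>k\<close> has \<open>k = 0\<close>. A kernel element \<open>(a b)\<^sup>k a\<close> would make the image of
\<open>(a b)\<^sup>k\<close> an involution, whence \<open>k = 0\<close> and \<open>a\<close> is killed; then the square of \<open>a b\<close> is killed as
well.\<close>
lemma (in group_hom) inj_on_two_involutions:
  assumes ab: "a \<in> carrier G" "b \<in> carrier G" "a \<otimes> a = \<one>" "b \<otimes> b = \<one>"
    and gen: "generate G {a, b} = carrier G"
    and inf: "infinite_dihedral H (h a) (h b)"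
  shows "inj_on h (carrier G)"
proof -
  let ?u = "h a \<otimes>\<^bsub>H\<^esub> h b"
  have u: "?u \<in> carrier H" using ab by simp
  have pow: "k = 0" if "?u [^]\<^bsub>H\<^esub> k = \<one>\<^bsub>H\<^esub>" for k :: int
  proof (rule ccontr)
    assume "k \<noteq> 0"
    obtain n :: nat where n: "k = int n \<or> k = - int n" by (rule int_cases2) auto
    then have "?u [^]\<^bsub>H\<^esub> n = \<one>\<^bsub>H\<^esub>"
      using that int_pow_int[of H ?u n] H.int_pow_neg_int[OF u, of n]
        H.inv_eq_1_iff[OF H.nat_pow_closed[OF u], of n]
      by (elim disjE) (simp_all only:)
    then show False using inf n \<open>k \<noteq> 0\<close> by (auto simp: infinite_dihedral_def)
  qed
  have "x = \<one>" if x: "x \<in> carrier G" "h x = \<one>\<^bsub>H\<^esub>" for x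
  proof -
    obtain k :: int where k: "x = (a \<otimes> b) [^] k \<or> x = (a \<otimes> b) [^] k \<otimes> a"
      using G.two_involutions_normal_form[OF ab] x(1) gen by blast
    have t: "h ((a \<otimes> b) [^] k) = ?u [^]\<^bsub>H\<^esub> k"
      using ab by (simp add: hom_int_pow)
    from k show ?thesis
    proof
      assume "x = (a \<otimes> b) [^] k"
      then show ?thesis using x(2) t pow[of k] by simp
    next
      assume "x = (a \<otimes> b) [^] k \<otimes> a"
      then have 1: "?u [^]\<^bsub>H\<^esub> k \<otimes>\<^bsub>H\<^esub> h a = \<one>\<^bsub>H\<^esub>"
        using x(2) t ab by simp
      have haa: "h a \<otimes>\<^bsub>H\<^esub> h a = \<one>\<^bsub>H\<^esub>" "h b \<otimes>\<^bsub>H\<^esub> h b = \<one>\<^bsub>H\<^esub>"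
        using ab by (metis hom_mult hom_one)+
      have "?u [^]\<^bsub>H\<^esub> k = inv\<^bsub>H\<^esub> h a"
        using H.inv_equality[OF 1] ab u by simp
      also have "\<dots> = h a"
        using haa ab by (simp add: H.inv_equality)
      finally have 2: "?u [^]\<^bsub>H\<^esub> k = h a" .
      then have "?u [^]\<^bsub>H\<^esub> (k + k) = \<one>\<^bsub>H\<^esub>"
        by (simp only: 2 haa H.int_pow_mult[OF u])
      then have "k = 0" using pow[of "k + k"] by simp
      then have "h a = \<one>\<^bsub>H\<^esub>" using 2 by simp
      then have "?u [^]\<^bsub>H\<^esub> (2 :: int) = \<one>\<^bsub>H\<^esub>"
        using haa ab H.int_pow_mult[OF u, of 1 1] u by simp
      then show ?thesis using pow[of 2] by simp
    qed
  qed
  then show ?thesis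
    using inj_iff_trivial_ker by (auto simp: kernel_def)
qed

definition free_product_relators ::
    "('a, 'c) monoid_scheme \<Rightarrow> ('b, 'd) monoid_scheme \<Rightarrow> ('a + 'b) word set" where
  "free_product_relators G H =
     {[(Inl x, True), (Inl y, True), (Inl (x \<otimes>\<^bsub>G\<^esub> y), False)] | x y.
         x \<in> carrier G \<and> y \<in> carrier G} \<union>
      {[(Inr x, True), (Inr y, True), (Inr (x \<otimes>\<^bsub>H\<^esub> y), False)] | x y.
         x \<in> carrier H \<and> y \<in> carrier H}"

definition free_product_gen ::
    "('a, 'c) monoid_scheme \<Rightarrow> ('b, 'd) monoid_scheme \<Rightarrow> 'a + 'b \<Rightarrow> ('a + 'b) word set set" where
  "free_product_gen G H = presented_gen (carrier G <+> carrier H) (free_product_relators G H)"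

lemma free_product_eq:
  "free_product G H = presented_group (carrier G <+> carrier H) (free_product_relators G H)"
  by (simp add: free_product_def free_product_relators_def)

locale two_groups = G: group G + H: group H for G (structure) and H (structure)
begin

lemma relators_words: "free_product_relators G H \<subseteq> words (carrier G <+> carrier H)"
  by (auto simp: free_product_relators_def)

lemma gen_closed: "z \<in> carrier G <+> carrier H \<Longrightarrow> free_product_gen G H z \<in> carrier (free_product G H)"
  unfolding free_product_gen_def free_product_eq using relators_words by (rule presented_gen_closed)

lemma generated: "generate (free_product G H) (free_product_gen G H ` (carrier G <+> carrier H)) =
    carrier (free_product G H)"
  unfolding free_product_gen_def free_product_eq using relators_words
  by (rule presented_group_generated)

lemma gen_Inl: "(\<lambda>x. free_product_gen G H (Inl x)) \<in> hom G (free_product G H)"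
  and gen_Inr: "(\<lambda>y. free_product_gen G H (Inr y)) \<in> hom H (free_product G H)"
proof -
  let ?P = "free_product G H" and ?g = "free_product_gen G H"
  interpret P: group ?P
    using G.group_axioms H.group_axioms by (rule group_free_product)
  have rel: "eval_word ?P ?g r = \<one>\<^bsub>?P\<^esub>" if "r \<in> free_product_relators G H" for r
    unfolding free_product_gen_def free_product_eq
    using relators_words that by (rule presented_group_relation)
  have eq: "?g z = ?g x \<otimes>\<^bsub>?P\<^esub> ?g y"
    if "[(x, True), (y, True), (z, False)] \<in> free_product_relators G H"
      "x \<in> carrier G <+> carrier H" "y \<in> carrier G <+> carrier H" "z \<in> carrier G <+> carrier H"
    for x y z
  proof -
    have c: "?g x \<in> carrier ?P" "?g y \<in> carrier ?P" "?g z \<in> carrier ?P"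
      using that(2-4) gen_closed by auto
    have "(?g x \<otimes>\<^bsub>?P\<^esub> ?g y) \<otimes>\<^bsub>?P\<^esub> inv\<^bsub>?P\<^esub> ?g z = \<one>\<^bsub>?P\<^esub>"
      using rel[OF that(1)] c by (simp add: P.m_assoc)
    then show ?thesis using c by (simp add: P.inv_solve_right')
  qed
  show "(\<lambda>x. ?g (Inl x)) \<in> hom G ?P"
  proof (rule homI)
    show "?g (Inl (x \<otimes>\<^bsub>G\<^esub> y)) = ?g (Inl x) \<otimes>\<^bsub>?P\<^esub> ?g (Inl y)"
      if "x \<in> carrier G" "y \<in> carrier G" for x y
      using that by (intro eq) (auto simp: free_product_relators_def)
  qed (auto intro!: gen_closed)
  show "(\<lambda>y. ?g (Inr y)) \<in> hom H ?P"
  proof (rule homI)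
    show "?g (Inr (x \<otimes>\<^bsub>H\<^esub> y)) = ?g (Inr x) \<otimes>\<^bsub>?P\<^esub> ?g (Inr y)"
      if "x \<in> carrier H" "y \<in> carrier H" for x y
      using that by (intro eq) (auto simp: free_product_relators_def)
  qed (auto intro!: gen_closed)
qed

lemma free_product_universal:
  assumes "group K" "\<phi> \<in> hom G K" "\<psi> \<in> hom H K"
  obtains h where "h \<in> hom (free_product G H) K"
    "\<And>x. x \<in> carrier G \<Longrightarrow> h (free_product_gen G H (Inl x)) = \<phi> x"
    "\<And>y. y \<in> carrier H \<Longrightarrow> h (free_product_gen G H (Inr y)) = \<psi> y"
proof -
  interpret K: group K by fact
  let ?f = "case_sum \<phi> \<psi>"
  have c: "\<phi> x \<in> carrier K" "\<psi> y \<in> carrier K" if "x \<in> carrier G" "y \<in> carrier H" for x y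
    using that assms(2,3) by (auto simp: hom_def)
  have "eval_word K ?f r = \<one>\<^bsub>K\<^esub>" if "r \<in> free_product_relators G H" for r
    using that assms(2,3)
    by (auto simp: free_product_relators_def hom_def Pi_iff simp flip: K.m_assoc)
  moreover have "?f \<in> carrier G <+> carrier H \<rightarrow> carrier K"
    using assms(2,3) by (auto simp: hom_def)
  ultimately obtain h where "h \<in> hom (free_product G H) K"
    "\<And>z. z \<in> carrier G <+> carrier H \<Longrightarrow> h (free_product_gen G H z) = ?f z"
    unfolding free_product_gen_def free_product_eq
    using presented_group_universal[OF relators_words assms(1)] by metis
  then show thesis using that[of h] by force
qed

end

abbreviation (input) "Z2 \<equiv> integer_mod_group 2"

interpretation Z2: two_groups Z2 Z2
  by (simp add: two_groups_def)

definition "Z2a = free_product_gen Z2 Z2 (Inl 1)"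
definition "Z2b = free_product_gen Z2 Z2 (Inr 1)"

lemma carrier_Z2: "carrier Z2 = {0, 1}"
  by (auto simp: carrier_integer_mod_group)

lemma free_Z2_universal:
  assumes "group K" "a \<in> carrier K" "b \<in> carrier K" "a \<otimes>\<^bsub>K\<^esub> a = \<one>\<^bsub>K\<^esub>" "b \<otimes>\<^bsub>K\<^esub> b = \<one>\<^bsub>K\<^esub>"
  obtains h where "h \<in> hom (free_product Z2 Z2) K" "h Z2a = a" "h Z2b = b"
proof -
  interpret K: group K by fact
  have "(\<lambda>x :: int. if x = 0 then \<one>\<^bsub>K\<^esub> else c) \<in> hom Z2 K"
    if "c \<in> carrier K" "c \<otimes>\<^bsub>K\<^esub> c = \<one>\<^bsub>K\<^esub>" for c
    using that by (auto simp: hom_def carrier_Z2)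
  then obtain h where h: "h \<in> hom (free_product Z2 Z2) K"
    "\<And>x. x \<in> carrier Z2 \<Longrightarrow> h (free_product_gen Z2 Z2 (Inl x)) = (if x = 0 then \<one>\<^bsub>K\<^esub> else a)"
    "\<And>y. y \<in> carrier Z2 \<Longrightarrow> h (free_product_gen Z2 Z2 (Inr y)) = (if y = 0 then \<one>\<^bsub>K\<^esub> else b)"
    using Z2.free_product_universal[OF assms(1), of "\<lambda>x. if x = 0 then \<one>\<^bsub>K\<^esub> else a"
        "\<lambda>x. if x = 0 then \<one>\<^bsub>K\<^esub> else b"] assms(2-5) by blast
  show thesis
    using that[OF h(1)] h(2)[of 1] h(3)[of 1] by (simp add: Z2a_def Z2b_def carrier_Z2)
qed

lemma free_Z2_generated:
  "generate (free_product Z2 Z2) {Z2a, Z2b} = carrier (free_product Z2 Z2)"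
  "Z2a \<in> carrier (free_product Z2 Z2)" "Z2b \<in> carrier (free_product Z2 Z2)"
proof -
  let ?P = "free_product Z2 Z2" and ?g = "free_product_gen Z2 Z2"
  interpret P: group ?P by (simp add: group_free_product)
  show ab: "Z2a \<in> carrier ?P" "Z2b \<in> carrier ?P"
    by (auto simp: Z2a_def Z2b_def carrier_Z2 intro!: Z2.gen_closed)
  have "?g (Inl 0) = \<one>\<^bsub>?P\<^esub>" "?g (Inr 0) = \<one>\<^bsub>?P\<^esub>"
    using hom_one[OF Z2.gen_Inl] hom_one[OF Z2.gen_Inr] P.group_axioms by simp_all
  then have "?g ` (carrier Z2 <+> carrier Z2) \<subseteq> generate ?P {Z2a, Z2b}"
    by (auto simp: carrier_Z2 Z2a_def Z2b_def generate.one intro: generate.incl)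
  then have "carrier ?P \<subseteq> generate ?P {Z2a, Z2b}"
    unfolding Z2.generated[symmetric] using ab
    by (intro P.generate_subgroup_incl P.generate_is_subgroup) auto
  then show "generate ?P {Z2a, Z2b} = carrier ?P"
    using P.generate_incl[of "{Z2a, Z2b}"] ab by blast
qed

lemma infinite_dihedral_free_Z2: "infinite_dihedral (free_product Z2 Z2) Z2a Z2b"
proof -
  let ?P = "free_product Z2 Z2"
  let ?a = "\<lambda>n :: int. - n" and ?b = "\<lambda>n :: int. 1 - n"
  interpret P: group ?P by (simp add: group_free_product)
  have "?a \<in> carrier perms" "?b \<in> carrier perms" "?a \<otimes>\<^bsub>perms\<^esub> ?a = \<one>\<^bsub>perms\<^esub>" "?b \<otimes>\<^bsub>perms\<^esub> ?b = \<one>\<^bsub>perms\<^esub>"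
    by (auto simp: fun_eq_iff intro!: bij_involution)
  then obtain h where h: "h \<in> hom ?P perms" "h Z2a = ?a" "h Z2b = ?b"
    using free_Z2_universal[OF group_perms, of ?a ?b] by blast
  interpret h: group_hom ?P perms h
    using h(1) by (simp add: group_hom_def group_hom_axioms_def group_perms P.group_axioms)
  note ab = free_Z2_generated(2,3)
  have pow: "h ((Z2a \<otimes>\<^bsub>?P\<^esub> Z2b) [^]\<^bsub>?P\<^esub> n) k = k - int n" for n :: nat and k
    using ab h(2,3) by (induction n arbitrary: k) auto
  have "(Z2a \<otimes>\<^bsub>?P\<^esub> Z2b) [^]\<^bsub>?P\<^esub> n \<noteq> \<one>\<^bsub>?P\<^esub>" if "n > 0" for n :: nat
    using that pow[of n 0] h.hom_one by auto
  moreover have "Z2a \<otimes>\<^bsub>?P\<^esub> Z2a = \<one>\<^bsub>?P\<^esub>" "Z2b \<otimes>\<^bsub>?P\<^esub> Z2b = \<one>\<^bsub>?P\<^esub>"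
    using hom_mult[OF Z2.gen_Inl, of 1 1] hom_mult[OF Z2.gen_Inr, of 1 1]
      hom_one[OF Z2.gen_Inl] hom_one[OF Z2.gen_Inr] P.group_axioms
    by (simp_all add: Z2a_def Z2b_def carrier_Z2)
  ultimately show ?thesis
    using ab by (auto simp: infinite_dihedral_def)
qed

text \<open>The free product maps onto the parabolic subgroup by its universal property, and injectively
because the product of the two reflections has infinite order.\<close>
lemma (in right_angled) nonadjacent_dihedral:
  assumes vw: "v \<in> V" "w \<in> V" "v \<noteq> w" "{v, w} \<notin> E"
  shows "W\<lparr>carrier := L {v, w}\<rparr> \<cong> free_product Z2 Z2"
proof -
  let ?P = "free_product Z2 Z2"
  interpret P: group ?P by (simp add: group_free_product)
  obtain \<delta> where \<delta>: "\<delta> \<in> hom W (perms :: (int \<Rightarrow> int) monoid)"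
    "\<delta> (s v) = (\<lambda>n. - n)" "\<delta> (s w) = (\<lambda>n. 1 - n)"
    using vw by (rule dihedral_hom)
  interpret \<delta>: group_hom W perms \<delta>
    using \<delta>(1) by (simp add: group_hom_def group_hom_axioms_def group_perms group_axioms)
  have pow: "\<delta> ((s v \<otimes> s w) [^] n) k = k - int n" for n :: nat and k
    using vw \<delta>(2,3) by (induction n arbitrary: k) auto
  have "(s v \<otimes> s w) [^] n \<noteq> \<one>" if "n > 0" for n :: nat
    using that pow[of n 0] \<delta>.hom_one by auto
  then have inf: "infinite_dihedral W (s v) (s w)"
    using vw by (simp add: infinite_dihedral_def)
  obtain h where h: "h \<in> hom ?P W" "h Z2a = s v" "h Z2b = s w"
    using free_Z2_universal[OF group_axioms, of "s v" "s w"] vw by auto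
  interpret h: group_hom ?P W h
    using h(1) by unfold_locales
  note ab = free_Z2_generated
  have "inj_on h (carrier ?P)"
    using infinite_dihedral_free_Z2 inf ab(1)
    by (intro h.inj_on_two_involutions[of Z2a Z2b]) (auto simp: infinite_dihedral_def h(2,3))
  moreover have "h ` carrier ?P = L {v, w}"
    using h.generate_img[of "{Z2a, Z2b}"] ab h(2,3) by simp
  ultimately have "h \<in> iso ?P (W\<lparr>carrier := L {v, w}\<rparr>)"
    by (auto simp: iso_def hom_def bij_betw_def)
  then show ?thesis
    using P.iso_sym unfolding is_iso_def by blast
qed


section \<open>Dihedral factors of a direct decomposition\<close>

lemma comm_group_virtually_abelian:
  assumes "comm_group G"
  shows "virtually_abelian G"
proof -
  interpret comm_group G by fact
  have "rcosets\<^bsub>G\<^esub> (carrier G) \<subseteq> {carrier G}"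
    using coset_join2[OF _ subgroup_self] by (auto simp: RCOSETS_def)
  then have "finite (rcosets\<^bsub>G\<^esub> (carrier G))" by (rule finite_subset) simp
  then show ?thesis
    unfolding virtually_abelian_def using subgroup_self assms by (intro exI[of _ "carrier G"]) simp
qed

context group
begin

definition centralizer :: "'a set \<Rightarrow> 'a set" where
  "centralizer X = {g \<in> carrier G. \<forall>x\<in>X. g \<otimes> x = x \<otimes> g}"

lemma centralizer_conj:
  "X \<subseteq> carrier G \<Longrightarrow> g \<in> centralizer X \<longleftrightarrow> g \<in> carrier G \<and> (\<forall>x\<in>X. conj_by g x = x)"
  by (auto simp: centralizer_def conj_eq_iff subset_iff)

lemma conj_inv_fixed:
  assumes "g \<in> carrier G" "x \<in> carrier G" "conj_by g x = x"
  shows "conj_by (inv g) x = x"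
proof -
  have "conj_by (inv g) x = conj_by (inv g) (conj_by g x)" using assms(3) by simp
  also have "\<dots> = conj_by (inv g \<otimes> g) x" using assms(1) by (simp only: conj_mult inv_closed comp_apply)
  finally show ?thesis using assms(1) by simp
qed

lemma subgroup_centralizer:
  assumes X: "X \<subseteq> carrier G"
  shows "subgroup (centralizer X) G"
proof (rule subgroupI)
  have "\<one> \<in> centralizer X"
    using X by (auto simp: centralizer_conj)
  then show "centralizer X \<noteq> {}" by blast
  show "inv g \<in> centralizer X" if "g \<in> centralizer X" for g
    using that X conj_inv_fixed[of g] by (auto simp: centralizer_conj)
  show "g \<otimes> h \<in> centralizer X" if "g \<in> centralizer X" "h \<in> centralizer X" for g h
    using that X by (auto simp: centralizer_conj conj_mult)
qed (auto simp: centralizer_def)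

lemma auto_image_centralizer:
  assumes f: "f \<in> auto G" and X: "X \<subseteq> carrier G" "f ` X = X"
  shows "f ` centralizer X = centralizer X"
proof -
  have hom: "f \<in> hom G G" and bij: "bij_betw f (carrier G) (carrier G)"
    using f by (auto simp: auto_def Bij_def)
  have *: "f g \<in> centralizer X \<longleftrightarrow> g \<in> centralizer X" if g: "g \<in> carrier G" for g
  proof -
    have "f g \<otimes> f x = f x \<otimes> f g \<longleftrightarrow> g \<otimes> x = x \<otimes> g" if "x \<in> X" for x
    proof -
      have x: "x \<in> carrier G" using that X by blast
      have "f g \<otimes> f x = f x \<otimes> f g \<longleftrightarrow> f (g \<otimes> x) = f (x \<otimes> g)"
        using g x by (simp add: hom_mult[OF hom])
      also have "\<dots> \<longleftrightarrow> g \<otimes> x = x \<otimes> g"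
        using g x inj_on_eq_iff[OF bij_betw_imp_inj_on[OF bij], of "g \<otimes> x" "x \<otimes> g"] by simp
      finally show ?thesis .
    qed
    then have "(\<forall>y\<in>f ` X. f g \<otimes> y = y \<otimes> f g) \<longleftrightarrow> (\<forall>x\<in>X. g \<otimes> x = x \<otimes> g)"
      by simp
    then show ?thesis
      using g hom_in_carrier[OF hom g] unfolding centralizer_def X(2) by simp
  qed
  have c: "centralizer X \<subseteq> carrier G" by (auto simp: centralizer_def)
  show ?thesis
  proof (intro equalityI subsetI)
    fix y assume y: "y \<in> centralizer X"
    then obtain g where "g \<in> carrier G" "y = f g"
      using c bij by (auto simp: bij_betw_def)
    then show "y \<in> f ` centralizer X" using * y by blast
  qed (use * c in blast)
qed

text \<open>Conjugation by any element fixes or inverts \<open>t = a b\<close>, since this holds for \<open>a\<close>, \<open>b\<close> and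
\<open>K\<close>. Hence \<open>t\<close> commutes with all squares, and an element commuting with the square \<open>t\<^sup>2\<close> cannot
invert \<open>t\<close> and so commutes with \<open>t\<close>. The centre \<open>A\<close> of the centralizer of the squares is therefore
an automorphism invariant abelian subgroup that contains \<open>t\<close>. It has infinite image in the
automorphism group because no power of \<open>t\<close> other than the identity is inverted by \<open>a\<close> and fixed by
it at the same time.\<close>
lemma infinite_dihedral_factor:
  assumes ab: "infinite_dihedral G a b"
    and K: "K \<subseteq> centralizer {a, b}" "generate G ({a, b} \<union> K) = carrier G"
  obtains N where "N \<lhd> AutoGroup G" "infinite N" "virtually_abelian ((AutoGroup G)\<lparr>carrier := N\<rparr>)"
proof -
  define t where "t = a \<otimes> b"
  have c: "a \<in> carrier G" "b \<in> carrier G" "a \<otimes> a = \<one>" "b \<otimes> b = \<one>"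
    and inf: "\<And>n :: nat. n > 0 \<Longrightarrow> t [^] n \<noteq> \<one>"
    using ab by (auto simp: infinite_dihedral_def t_def)
  have inv: "inv a = a" "inv b = b" using c by (simp_all add: inv_equality)
  have t: "t \<in> carrier G" using c by (simp add: t_def)
  have conj_group: "group_hom G G (conj_by g)" if "g \<in> carrier G" for g
    using that by unfold_locales (auto simp: hom_def conj_distrib)
  have conj_inv: "conj_by g (inv t) = inv (conj_by g t)" if "g \<in> carrier G" for g
    using group_hom.hom_inv[OF conj_group[OF that] t] .
  have at: "conj_by a t = inv t"
    using c inv by (simp add: t_def conj_by_def inv_mult_group m_assoc[symmetric])
  have bt: "conj_by b t = inv t"
    using c inv by (simp add: t_def conj_by_def inv_mult_group m_assoc)
  have kt: "conj_by k t = t" "k \<in> carrier G" if "k \<in> K" for k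
  proof -
    have k: "k \<in> carrier G" "conj_by k a = a" "conj_by k b = b"
      using that K(1) c by (auto simp: centralizer_conj subset_iff)
    then show "conj_by k t = t" "k \<in> carrier G" using c by (auto simp: t_def conj_distrib)
  qed
  have *: "conj_by h t = t \<or> conj_by h t = inv t" if "h \<in> carrier G" for h
    using that[folded K(2)]
  proof induction
    case one
    show ?case by simp
  next
    case (incl h)
    then show ?case using at bt kt by blast
  next
    case (inv h)
    then consider "h = a" | "h = b" | "h \<in> K" by blast
    then show ?case
      using at bt \<open>inv a = a\<close> \<open>inv b = b\<close> conj_inv_fixed[OF _ t] kt by cases auto
  next
    case (eng x y)
    have xy: "x \<in> carrier G" "y \<in> carrier G"
      using eng.hyps unfolding K(2) by auto
    then show ?case using eng.IH t by (auto simp: conj_mult conj_inv)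
  qed
  let ?Q = "(\<lambda>h. h \<otimes> h) ` carrier G"
  have Q: "?Q \<subseteq> carrier G" by auto
  define S where "S = centralizer ?Q"
  have S: "S \<subseteq> carrier G" by (auto simp: S_def centralizer_def)
  define A where "A = S \<inter> centralizer S"
  have A: "subgroup A G"
    unfolding A_def S_def using Q S[unfolded S_def]
    by (intro subgroups_Inter_pair subgroup_centralizer)
  have A_comm: "x \<otimes> y = y \<otimes> x" if "x \<in> A" "y \<in> A" for x y
    using that unfolding A_def centralizer_def by blast
  have sq: "conj_by (h \<otimes> h) t = t" if "h \<in> carrier G" for h
    using *[OF that] that t by (auto simp: conj_mult conj_inv)
  have "t \<otimes> (h \<otimes> h) = (h \<otimes> h) \<otimes> t" if "h \<in> carrier G" for h
    using sq[OF that] that t by (simp add: conj_eq_iff)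
  then have "t \<in> S"
    using t unfolding S_def centralizer_def by blast
  moreover have "t \<otimes> h = h \<otimes> t" if h: "h \<in> S" for h
  proof -
    have hc: "h \<in> carrier G" using h S by blast
    have "h \<otimes> (t \<otimes> t) = (t \<otimes> t) \<otimes> h"
      using h t unfolding S_def centralizer_def by blast
    then have "conj_by h (t \<otimes> t) = t \<otimes> t"
      using t hc by (simp add: conj_eq_iff)
    then have tt: "conj_by h t \<otimes> conj_by h t = t \<otimes> t"
      using hc t by (simp add: conj_distrib)
    have "conj_by h t \<noteq> inv t"
    proof
      assume "conj_by h t = inv t"
      then have "inv (t \<otimes> t) = t \<otimes> t" using tt t by (simp add: inv_mult_group)
      then have "(t \<otimes> t) \<otimes> (t \<otimes> t) = \<one>" using t by (metis l_inv m_closed)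
      then have "t [^] (4 :: nat) = \<one>" using t by (simp add: eval_nat_numeral m_assoc)
      then show False using inf[of 4] by simp
    qed
    then show ?thesis using *[OF hc] hc t by (simp add: conj_eq_iff)
  qed
  ultimately have tA: "t \<in> A"
    using t unfolding A_def centralizer_def by blast
  have fA: "f ` A = A" if f: "f \<in> auto G" for f
  proof -
    have bij: "bij_betw f (carrier G) (carrier G)" and hom: "f \<in> hom G G"
      using f by (auto simp: auto_def Bij_def)
    have "f ` ?Q = (\<lambda>h. h \<otimes> h) ` (f ` carrier G)"
      using hom_mult[OF hom] by (simp add: image_image cong: image_cong_simp)
    then have "f ` ?Q = ?Q" using bij by (simp add: bij_betw_def)
    then have "f ` S = S" unfolding S_def using f Q by (intro auto_image_centralizer)
    moreover from this have "f ` centralizer S = centralizer S"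
      using f S by (intro auto_image_centralizer)
    moreover have "f ` A = f ` S \<inter> f ` centralizer S"
      unfolding A_def using bij S
      by (intro inj_on_image_Int[of f "carrier G"]) (auto simp: bij_betw_def centralizer_def)
    ultimately show ?thesis by (simp add: A_def)
  qed
  let ?Au = "AutoGroup G"
  interpret Au: group ?Au by (rule AutoGroup)
  interpret i: group_hom G ?Au inner
    using inner_hom by unfold_locales
  have N: "inner ` A \<lhd> ?Au"
  proof (rule Au.normal_invI)
    show "subgroup (inner ` A) ?Au" using A by (rule i.subgroup_img_is_subgroup)
    show "f \<otimes>\<^bsub>?Au\<^esub> n \<otimes>\<^bsub>?Au\<^esub> inv\<^bsub>?Au\<^esub> f \<in> inner ` A"
      if f: "f \<in> carrier ?Au" and n: "n \<in> inner ` A" for f n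
    proof -
      obtain g where g: "g \<in> A" "n = inner g" using n by blast
      have "f g \<in> A" using fA[of f] f g(1) by auto
      then show ?thesis
        using auto_inner[of f g] f g subgroup.mem_carrier[OF A] by auto
    qed
  qed
  moreover have "infinite (inner ` A)"
  proof
    assume fin: "finite (inner ` A)"
    have "t [^] n \<in> A" for n :: nat
      using tA subgroup.one_closed[OF A] subgroup.m_closed[OF A] by (induction n) auto
    then have "range (\<lambda>n :: nat. inner (t [^] n)) \<subseteq> inner ` A" by blast
    then have "finite (range (\<lambda>n :: nat. inner (t [^] n)))"
      using fin finite_subset by blast
    then have "\<not> inj (\<lambda>n :: nat. inner (t [^] n))"
      using finite_imageD by blast
    then obtain k l :: nat where kl: "k < l" "inner (t [^] k) = inner (t [^] l)"
      unfolding inj_def by (metis linorder_neqE_nat)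
    define m where "m = l - k"
    have "inner (t [^] l) = inner (t [^] m) \<otimes>\<^bsub>?Au\<^esub> inner (t [^] k)"
      using kl(1) t by (simp add: m_def nat_pow_mult flip: i.hom_mult)
    then have "inner (t [^] m) = \<one>\<^bsub>?Au\<^esub>"
      using kl(2) t Au.r_cancel_one'[of "inner (t [^] k)" "inner (t [^] m)"] inner_auto by simp
    then have "t [^] m \<otimes> a = a \<otimes> t [^] m"
      using inner_eq_one_iff[of "t [^] m"] t c by simp
    then have "t [^] m = conj_by a (t [^] m)"
      using c(1) t conj_eq_iff[of a "t [^] m"] by simp
    also have "\<dots> = inv (t [^] m)"
      using group_hom.hom_nat_pow[OF conj_group[OF c(1)] t, of m] at t
      by (simp add: nat_pow_inv)
    finally have "t [^] m \<otimes> t [^] m = \<one>"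
      using t by (metis nat_pow_closed r_inv)
    then have "t [^] (m + m) = \<one>" using t by (simp add: nat_pow_mult)
    then show False using inf[of "m + m"] kl(1) by (simp add: m_def)
  qed
  moreover have "virtually_abelian (?Au\<lparr>carrier := inner ` A\<rparr>)"
  proof (rule comm_group_virtually_abelian, rule group.group_comm_groupI)
    show "group (?Au\<lparr>carrier := inner ` A\<rparr>)"
      using normal_imp_subgroup[OF N] Au.group_axioms by (rule subgroup.subgroup_is_group)
    show "x \<otimes>\<^bsub>?Au\<lparr>carrier := inner ` A\<rparr>\<^esub> y = y \<otimes>\<^bsub>?Au\<lparr>carrier := inner ` A\<rparr>\<^esub> x"
      if xy: "x \<in> carrier (?Au\<lparr>carrier := inner ` A\<rparr>)" "y \<in> carrier (?Au\<lparr>carrier := inner ` A\<rparr>)" for x y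
    proof -
      obtain g h where gh: "g \<in> A" "h \<in> A" "x = inner g" "y = inner h" using xy by auto
      then show ?thesis
        using A_comm[OF gh(1,2)] subgroup.mem_carrier[OF A] by (simp flip: i.hom_mult)
    qed
  qed
  ultimately show thesis using that by blast
qed

lemma generate_commute:
  assumes "X \<subseteq> carrier G" "Y \<subseteq> carrier G" "\<And>x y. x \<in> X \<Longrightarrow> y \<in> Y \<Longrightarrow> x \<otimes> y = y \<otimes> x"
    and xy: "x \<in> generate G X" "y \<in> generate G Y"
  shows "x \<otimes> y = y \<otimes> x"
proof -
  have "X \<subseteq> centralizer Y" using assms(1,3) by (auto simp: centralizer_def)
  then have "generate G X \<subseteq> centralizer Y"
    using subgroup_centralizer[OF assms(2)] by (rule generate_subgroup_incl)
  then have "Y \<subseteq> centralizer {x}"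
    using xy(1) assms(2) by (fastforce simp: centralizer_def)
  moreover have "x \<in> carrier G" using generate_in_carrier[OF assms(1) xy(1)] .
  ultimately have "generate G Y \<subseteq> centralizer {x}"
    using subgroup_centralizer[of "{x}"] by (intro generate_subgroup_incl) auto
  then show ?thesis using xy(2) by (auto simp: centralizer_def)
qed

lemma generate_self: "subgroup H G \<Longrightarrow> generate G H = H"
  using generate_subgroup_incl[of H H] by (auto intro: generate.incl)

end

context right_angled
begin

lemma join_decomposable:
  assumes X: "X \<subseteq> V" and AB: "X = A \<union> B" "A \<inter> B = {}" "A \<noteq> {}" "B \<noteq> {}"
    and join: "\<And>u v. u \<in> A \<Longrightarrow> v \<in> B \<Longrightarrow> {u, v} \<in> E"
  shows "directly_decomposable V E X"
proof -
  have V: "A \<subseteq> V" "B \<subseteq> V" using X AB(1) by auto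
  let ?P = "W\<lparr>carrier := L X\<rparr>"
  define H where "H c = L (if c then A else B)" for c
  have HX: "H c \<subseteq> L X" for c
    unfolding H_def using AB(1) by (intro mono_generate image_mono) auto
  have Hs: "subgroup (H c) W" for c using V L_subgroup by (simp add: H_def)
  have comm: "x \<otimes> y = y \<otimes> x" if "x \<in> L A" "y \<in> L B" for x y
  proof (rule generate_commute[OF s_image[OF V(1)] s_image[OF V(2)] _ that])
    fix x y assume "x \<in> s ` A" "y \<in> s ` B"
    then obtain u v where uv: "u \<in> A" "v \<in> B" "x = s u" "y = s v" by blast
    then have "s u \<otimes> s v = s v \<otimes> s u"
      using V by (intro s_comm join) auto
    then show "x \<otimes> y = y \<otimes> x" using uv by simp
  qed
  have "internal_direct_product ?P UNIV H"
    unfolding internal_direct_product_def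
  proof (intro conjI ballI impI)
    show "subgroup (H c) ?P" for c
      using HX Hs L_subgroup[OF X] by (simp add: subgroup_incl)
    show "x \<otimes>\<^bsub>?P\<^esub> y = y \<otimes>\<^bsub>?P\<^esub> x" if "c \<noteq> d" "x \<in> H c" "y \<in> H d" for c d x y
    proof (cases c)
      case True
      then show ?thesis using that comm[of x y] by (simp add: H_def)
    next
      case False
      then show ?thesis using that comm[of y x] by (simp add: H_def)
    qed
    have "generate W (\<Union>c. H c) = L X"
    proof
      show "generate W (\<Union>c. H c) \<subseteq> L X"
        using HX L_subgroup[OF X] by (intro generate_subgroup_incl) auto
      have "s ` X \<subseteq> H True \<union> H False"
        unfolding AB(1) H_def by (auto intro: generate.incl)
      then show "L X \<subseteq> generate W (\<Union>c. H c)"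
        by (intro mono_generate) blast
    qed
    then show "generate ?P (\<Union>c\<in>UNIV. H c) = carrier ?P"
      using generate_consistent[OF _ L_subgroup[OF X], of "\<Union>c. H c"] HX by auto
    show "H c \<inter> generate ?P (\<Union>d\<in>UNIV - {c}. H d) = {\<one>\<^bsub>?P\<^esub>}" for c
    proof -
      have "UNIV - {c} = {\<not> c}" by auto
      then have "generate ?P (\<Union>d\<in>UNIV - {c}. H d) = H (\<not> c)"
        using generate_consistent[OF HX L_subgroup[OF X]] generate_self[OF Hs] by simp
      moreover have "H c \<inter> H (\<not> c) \<subseteq> {\<one>}"
        using L_disjoint[OF V AB(2)] by (cases c) (auto simp: H_def)
      moreover have "\<one> \<in> H c \<inter> H (\<not> c)"
        using Hs subgroup.one_closed by blast
      ultimately show ?thesis by auto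
    qed
  qed
  moreover have "W\<lparr>carrier := L X\<rparr> = parabolic_group V E X"
    by (simp add: special_parabolic_eq W_eq)
  moreover have "H = (\<lambda>c. special_parabolic V E (if c then A else B))"
    by (simp add: H_def special_parabolic_eq fun_eq_iff)
  moreover have "A \<subset> X" "B \<subset> X" using AB by auto
  ultimately show ?thesis
    unfolding directly_decomposable_def by metis
qed

context
  fixes n :: nat and \<Gamma> :: "nat \<Rightarrow> 'a set"
  assumes sub: "\<And>i. i \<in> {1..n} \<Longrightarrow> \<Gamma> i \<subseteq> V"
    and product: "internal_direct_product (racg V E) {1..n} (\<lambda>i. special_parabolic V E (\<Gamma> i))"
begin

lemma factors_commute:
  "i \<in> {1..n} \<Longrightarrow> j \<in> {1..n} \<Longrightarrow> i \<noteq> j \<Longrightarrow> x \<in> L (\<Gamma> i) \<Longrightarrow> y \<in> L (\<Gamma> j) \<Longrightarrow> x \<otimes> y = y \<otimes> x"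
  using product[unfolded internal_direct_product_def special_parabolic_eq, folded W_eq,
      THEN conjunct2, THEN conjunct1] by blast

lemma factors_generate: "generate W (\<Union>i\<in>{1..n}. L (\<Gamma> i)) = carrier W"
  using product[unfolded internal_direct_product_def special_parabolic_eq, folded W_eq,
      THEN conjunct2, THEN conjunct2, THEN conjunct1] .

text \<open>Otherwise the factors would all lie in the parabolic subgroup of \<open>V - {v}\<close>, which does not
contain \<open>s v\<close>.\<close>
lemma vertex_in_factor:
  assumes v: "v \<in> V"
  shows "\<exists>i\<in>{1..n}. v \<in> \<Gamma> i"
proof (rule ccontr)
  assume "\<not> ?thesis"
  then have "\<Gamma> i \<subseteq> V - {v}" if "i \<in> {1..n}" for i using sub that by blast
  then have "(\<Union>i\<in>{1..n}. L (\<Gamma> i)) \<subseteq> L (V - {v})"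
    by (intro UN_least mono_generate image_mono)
  then have "carrier W \<subseteq> L (V - {v})"
    unfolding factors_generate[symmetric] using L_subgroup[of "V - {v}"]
    by (intro generate_subgroup_incl) auto
  then have "s v \<in> L (V - {v})" using v by auto
  moreover have "s v \<in> L {v}" by (auto intro: generate.incl)
  ultimately have "s v = \<one>" using v by (intro L_disjoint[of "V - {v}" "{v}"]) auto
  then show False using s_not_one[OF v] by simp
qed

text \<open>If \<open>v\<close> had fewer than four conjugates, all vertices besides \<open>v\<close> and \<open>w\<close> would be adjacent to
both of them. As distinct factors commute, \<open>v\<close> and \<open>w\<close> lie in the same factor, which is then
either dihedral or a join with \<open>{v, w}\<close>.\<close>
lemma four_conjugates:
  assumes indec: "\<And>i. i \<in> {1..n} \<Longrightarrow> \<not> directly_decomposable V E (\<Gamma> i)"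
    and no_dihedral: "\<And>i. i \<in> {1..n} \<Longrightarrow> \<not> parabolic_group V E (\<Gamma> i) \<cong> free_product Z2 Z2"
    and vw: "v \<in> V" "w \<in> V" "w \<noteq> v" "{v, w} \<notin> E"
  shows "\<exists>D \<subseteq> conjugates v. card D = 4"
proof (rule ccontr)
  assume none: "\<not> ?thesis"
  have joined: "{v, u} \<in> E" "{w, u} \<in> E" if u: "u \<in> V" "u \<noteq> v" "u \<noteq> w" for u
  proof -
    show "{v, u} \<in> E"
      using four_conjugates_fork[OF vw(1) u(1) vw(2) u(2) vw(3) u(3) _ vw(4)] none by blast
    have "{u, w} \<in> E"
      using four_conjugates_path[OF vw(1) u(1) vw(2) u(2) vw(3) u(3) vw(4)] none by blast
    then show "{w, u} \<in> E" by (simp add: insert_commute)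
  qed
  obtain i where i: "i \<in> {1..n}" "v \<in> \<Gamma> i" using vertex_in_factor[OF vw(1)] by blast
  obtain j where j: "j \<in> {1..n}" "w \<in> \<Gamma> j" using vertex_in_factor[OF vw(2)] by blast
  have "s v \<otimes> s w \<noteq> s w \<otimes> s v"
    using vw by (intro nonadjacent_not_commute) auto
  then have "i = j"
    using factors_commute[OF i(1) j(1), of "s v" "s w"] i(2) j(2) by (metis generate.incl imageI)
  then have w: "w \<in> \<Gamma> i" using j(2) by simp
  show False
  proof (cases "\<Gamma> i = {v, w}")
    case True
    have "v \<noteq> w" using vw(3) by simp
    with nonadjacent_dihedral[OF vw(1,2) this vw(4)] no_dihedral[OF i(1)] True
    show False by (simp add: special_parabolic_eq W_eq)
  next
    case False
    have "directly_decomposable V E (\<Gamma> i)"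
    proof (rule join_decomposable)
      show "\<Gamma> i \<subseteq> V" using sub[OF i(1)] .
      show "\<Gamma> i = {v, w} \<union> (\<Gamma> i - {v, w})" using i(2) w by blast
      show "\<Gamma> i - {v, w} \<noteq> {}" using i(2) w False by blast
      show "{x, y} \<in> E" if "x \<in> {v, w}" "y \<in> \<Gamma> i - {v, w}" for x y
        using that joined[of y] sub[OF i(1)] by auto
    qed auto
    then show False using indec[OF i(1)] by blast
  qed
qed

lemma dihedral_factor:
  assumes i: "i \<in> {1..n}" and iso: "parabolic_group V E (\<Gamma> i) \<cong> free_product Z2 Z2"
  shows "\<exists>N. N \<lhd> AutoGroup W \<and> infinite N \<and> virtually_abelian ((AutoGroup W)\<lparr>carrier := N\<rparr>)"
proof -
  let ?F = "free_product Z2 Z2" and ?P = "W\<lparr>carrier := L (\<Gamma> i)\<rparr>"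
  interpret F: group ?F by (simp add: group_free_product)
  have sub_i: "subgroup (L (\<Gamma> i)) W" using sub[OF i] by (rule L_subgroup)
  interpret P: group ?P using sub_i group_axioms by (rule subgroup.subgroup_is_group)
  have "?P \<cong> ?F" using iso by (simp add: special_parabolic_eq W_eq)
  then obtain h where h: "h \<in> iso ?F ?P"
    using P.iso_sym unfolding is_iso_def by blast
  then have hom: "h \<in> hom ?F W" and img: "h ` carrier ?F = L (\<Gamma> i)" and inj: "inj_on h (carrier ?F)"
    using subgroup.subset[OF sub_i] by (auto simp: iso_def hom_def bij_betw_def)
  interpret h: group_hom ?F W h using hom by unfold_locales
  note ab = free_Z2_generated(2,3)
  let ?a = "h Z2a" and ?b = "h Z2b"
  have D: "Z2a \<otimes>\<^bsub>?F\<^esub> Z2a = \<one>\<^bsub>?F\<^esub>" "Z2b \<otimes>\<^bsub>?F\<^esub> Z2b = \<one>\<^bsub>?F\<^esub>"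
    "\<And>n :: nat. n > 0 \<Longrightarrow> (Z2a \<otimes>\<^bsub>?F\<^esub> Z2b) [^]\<^bsub>?F\<^esub> n \<noteq> \<one>\<^bsub>?F\<^esub>"
    using infinite_dihedral_free_Z2 by (auto simp: infinite_dihedral_def)
  have "infinite_dihedral W ?a ?b"
    unfolding infinite_dihedral_def
  proof (intro conjI allI impI)
    show "?a \<otimes> ?a = \<one>" "?b \<otimes> ?b = \<one>"
      using ab D(1,2) h.hom_one by (simp_all flip: h.hom_mult)
    show "(?a \<otimes> ?b) [^] m \<noteq> \<one>" if "m > 0" for m :: nat
    proof
      assume "(?a \<otimes> ?b) [^] m = \<one>"
      then have "h ((Z2a \<otimes>\<^bsub>?F\<^esub> Z2b) [^]\<^bsub>?F\<^esub> m) = h \<one>\<^bsub>?F\<^esub>"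
        using ab by (simp add: h.hom_nat_pow)
      then show False using inj D(3)[OF that] ab by (simp add: inj_on_def)
    qed
  qed (use ab in auto)
  moreover have abP: "?a \<in> L (\<Gamma> i)" "?b \<in> L (\<Gamma> i)" using ab img by blast+
  define K where "K = (\<Union>j\<in>{1..n} - {i}. L (\<Gamma> j))"
  have Lc: "L (\<Gamma> j) \<subseteq> carrier W" if "j \<in> {1..n}" for j
    using L_carrier[OF sub[OF that]] by blast
  have "K \<subseteq> centralizer {?a, ?b}"
    using Lc abP factors_commute[OF _ i] by (fastforce simp: K_def centralizer_def)
  moreover have "generate W ({?a, ?b} \<union> K) = carrier W"
  proof
    have "K \<subseteq> carrier W" unfolding K_def by (rule UN_least) (use Lc in blast)
    then have c: "{?a, ?b} \<union> K \<subseteq> carrier W" using ab by simp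
    then show "generate W ({?a, ?b} \<union> K) \<subseteq> carrier W" by (rule generate_incl)
    have "L (\<Gamma> i) = generate W {?a, ?b}"
      using h.generate_img[of "{Z2a, Z2b}"] free_Z2_generated img by simp
    then have "L (\<Gamma> i) \<subseteq> generate W ({?a, ?b} \<union> K)"
      using mono_generate[of "{?a, ?b}" "{?a, ?b} \<union> K"] by blast
    then have "(\<Union>j\<in>{1..n}. L (\<Gamma> j)) \<subseteq> generate W ({?a, ?b} \<union> K)"
      by (auto simp: K_def intro: generate.incl)
    then show "carrier W \<subseteq> generate W ({?a, ?b} \<union> K)"
      unfolding factors_generate[symmetric]
      using generate_is_subgroup[OF c] by (rule generate_subgroup_incl)
  qed
  ultimately show ?thesis
    using infinite_dihedral_factor[of ?a ?b K] by metis
qed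

end

end

theorem corollaryF:
  fixes V :: "'a set" and E :: "'a set set" and n :: nat and \<Gamma> :: "nat \<Rightarrow> 'a set"
  assumes "finite_simplicial_graph V E"
    and "\<And>i. i \<in> {1..n} \<Longrightarrow> \<Gamma> i \<subseteq> V"
    and "internal_direct_product (racg V E) {1..n} (\<lambda>i. special_parabolic V E (\<Gamma> i))"
    and "\<And>i. i \<in> {1..n} \<Longrightarrow> \<not> directly_decomposable V E (\<Gamma> i)"
  shows "((\<exists>N. N \<lhd> AutoGroup (racg V E) \<and> infinite N \<and>
             virtually_abelian ((AutoGroup (racg V E))\<lparr>carrier := N\<rparr>)) \<longleftrightarrow>
          (\<exists>i\<in>{1..n}. parabolic_group V E (\<Gamma> i) \<cong>
             free_product (integer_mod_group 2) (integer_mod_group 2))) \<and>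
         (\<not> (\<exists>i\<in>{1..n}. parabolic_group V E (\<Gamma> i) \<cong>
               free_product (integer_mod_group 2) (integer_mod_group 2)) \<longrightarrow>
          (\<forall>N. N \<lhd> AutoGroup (racg V E) \<longrightarrow>
             finite N \<or> full_sized ((AutoGroup (racg V E))\<lparr>carrier := N\<rparr>)))"
proof -
  let ?A = "AutoGroup (racg V E)"
  let ?dihedral = "\<exists>i\<in>{1..n}. parabolic_group V E (\<Gamma> i) \<cong> free_product Z2 Z2"
  interpret right_angled "racg V E" V E "presented_gen V (racg_relators V E)"
    using assms(1) by (simp add: right_angled_def right_angled_axioms_def group_racg)
  have dichotomy: "finite N \<or> full_sized (?A\<lparr>carrier := N\<rparr>)"
    if "\<not> ?dihedral" "N \<lhd> ?A" for N
    using that four_conjugates[OF assms(2-4)] by (intro normal_subgroup_dichotomy) blast+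
  have "?dihedral" if N: "N \<lhd> ?A" "infinite N" "virtually_abelian (?A\<lparr>carrier := N\<rparr>)" for N
  proof (rule ccontr)
    assume "\<not> ?dihedral"
    then have "full_sized (?A\<lparr>carrier := N\<rparr>)" using dichotomy N(1,2) by blast
    moreover have "group (?A\<lparr>carrier := N\<rparr>)"
      using normal_imp_subgroup[OF N(1)] AutoGroup by (rule subgroup.subgroup_is_group)
    ultimately show False using virtually_abelian_not_full_sized N(3) by blast
  qed
  moreover have "\<exists>N. N \<lhd> ?A \<and> infinite N \<and> virtually_abelian (?A\<lparr>carrier := N\<rparr>)" if ?dihedral
    using that dihedral_factor[OF assms(2,3)] by blast
  ultimately show ?thesis using dichotomy by blast
qed

end
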